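(* For every $\epsilon>0$ and $0<p<1$ there exist $b,d,\delta>0$ and, for infinitely many values of $n$, a $(b,d)$-expander $\mathcal{G}$ on $n$ vertices with a prescribed vertex $v$, such that the random graph $G\sim\mathcal{G}_p$ satisfies \[ \mathbb{P}\big(\mathrm{diam}(\mathcal{C}_v(G)) \geq (1-\epsilon)\,\mathrm{diam}(\mathcal{G})\big)\geq 1-\epsilon, \] and yet, with probability tending to $1$ as $n\to\infty$ (along these values of $n$), there are no connected components of size larger than $n^{1-\delta}$ in $G$.
   Context: A graph $\mathcal{G}$ is a $(b,d)$-expander if its maximum degree is $d$ and for every $S\subset V(\mathcal{G})$ with $|S|\le |V(\mathcal{G})|/2$ there are at least $b|S|$ edges between $S$ and $V(\mathcal{G})\setminus S$ (the expander is not required to be regular). For $0<p<1$, $\mathcal{G}_p$ denotes bond percolation on $\mathcal{G}$: the random spanning subgraph of $\mathcal{G}$ in which each edge is present independently with probability $p$. $\mathcal{C}_v(G)$ denotes the connected component of the vertex $v$ in $G$; its size is its number of vertices, and $\mathrm{diam}$ denotes the diameter of a connected graph in its own graph metric. *)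

theory Defs
  imports "HOL-Probability.Probability"
begin

record 'a ugraph =
  verts :: "'a set"
  edges :: "'a set set"

definition simple_graph :: "'a ugraph \<Rightarrow> bool" where
  "simple_graph G \<longleftrightarrow> finite (verts G) \<and> (\<forall>e\<in>edges G. e \<subseteq> verts G \<and> card e = 2)"

definition vdegree :: "'a ugraph \<Rightarrow> 'a \<Rightarrow> nat" where
  "vdegree G x = card {e \<in> edges G. x \<in> e}"

definition max_degree :: "'a ugraph \<Rightarrow> nat" where
  "max_degree G = Max (vdegree G ` verts G)"

definition edge_boundary :: "'a ugraph \<Rightarrow> 'a set \<Rightarrow> 'a set set" where
  "edge_boundary G S = {e \<in> edges G. \<exists>x\<in>S. \<exists>y\<in>verts G - S. e = {x, y}}"

definition expander :: "real \<Rightarrow> nat \<Rightarrow> 'a ugraph \<Rightarrow> bool" where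
  "expander b d G \<longleftrightarrow> simple_graph G \<and> max_degree G = d \<and>
     (\<forall>S \<subseteq> verts G. real (card S) \<le> real (card (verts G)) / 2 \<longrightarrow>
        real (card (edge_boundary G S)) \<ge> b * real (card S))"

definition adj :: "'a ugraph \<Rightarrow> 'a rel" where
  "adj G = {(x, y). {x, y} \<in> edges G}"

(* Only meaningful for x and y in the same connected component: otherwise no k qualifies
   and the value is unspecified. *)
definition gdist :: "'a ugraph \<Rightarrow> 'a \<Rightarrow> 'a \<Rightarrow> nat" where
  "gdist G x y = (LEAST k. (x, y) \<in> adj G ^^ k)"

(* Only meaningful for nonempty finite connected graphs, such as connected components of a
   simple graph, or expanders with b > 0. *)
definition diam :: "'a ugraph \<Rightarrow> nat" where
  "diam G = Max {gdist G x y | x y. x \<in> verts G \<and> y \<in> verts G}"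

(* A graph of its own (not just a vertex set), so that diam of it uses its own graph metric. *)
definition component :: "'a ugraph \<Rightarrow> 'a \<Rightarrow> 'a ugraph" where
  "component G v =
     (let C = {w \<in> verts G. (v, w) \<in> (adj G)\<^sup>*}
      in \<lparr>verts = C, edges = {e \<in> edges G. e \<subseteq> C}\<rparr>)"

definition percolation :: "'a ugraph \<Rightarrow> real \<Rightarrow> 'a ugraph pmf" where
  "percolation G p =
     map_pmf (\<lambda>\<omega>. \<lparr>verts = verts G, edges = {e \<in> edges G. \<omega> e}\<rparr>)
       (Pi_pmf (edges G) False (\<lambda>_. bernoulli_pmf p))"

end

theory Submission
  imports Defs "HOL-Combinatorics.Permutations" "HOL-Library.Discrete_Functions"
begin

text \<open>
  The idea is to attach a sparse part to a large expander: a binary tree whose edges are long but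
  very robust, and which has far fewer vertices than the expander but determines the diameter.

  Start from an expander on $4^D$ vertices and a binary tree of depth $D$ whose $2^D$ leaves are
  vertices of the expander. The result is still an expander, since a set of tree vertices without
  its descendants has many edges to its children (\<open>base_expansion\<close>). Now replace every edge by a
  chain, of length $2K$ and with $m$ parallel paths per step in the tree, and of length $2L$ and
  width one in the expander. Expansion survives this up to a constant factor, because a set either
  cuts a chain or treats it like its endpoints (\<open>expansion\<close>).

  The number $L$ only depends on $p$ and is so large that percolation on the expander part is
  strongly subcritical: with high probability no simple path of length $D/16$ consists of passed
  chains, and so clusters have at most $2^{D/4}$ vertices of the expander. A component of $G$ can
  contain the whole tree and the clusters of all leaves, but this amounts to only about
  $2^D \cdot 2^{D/4}$ out of at least $4^D$ vertices (\<open>card_component_le\<close>). This does not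
  keep the component of the root of the tree from reaching far: $m$ is chosen such that every
  chain in the tree is blocked with small probability, and then the root is connected to some leaf
  with high probability by comparison with a branching process (\<open>prob_not_survives_le\<close>).

  Every leaf has distance $2KD$ from the root. On the other hand, any two vertices of the tree are
  joined both through the root and through leaves and the expander, where distances are at most a
  multiple of $LD$. As one of these two ways is short, the diameter of $G$ is at most $2KD$ plus a multiple of
  $LD$ (\<open>diam_G_le\<close>). So if $K$ is much larger than $L / \epsilon$, the component of
  the root has almost the diameter of $G$.

  Expanders of bounded degree exist by counting: not all choices of eight permutations of a finite
  set can fail to have the property that the images of every subset $S$ of at most half the size
  contain at least $|S| / 16$ points outside $S$ (\<open>expanding_permutations_exist\<close>).
\<close>

section \<open>Vertex expanders from random permutations\<close>

lemma choose_mult_power_le: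
  fixes x :: real
  assumes "0 \<le> x"
  shows "real (n choose k) * x ^ k \<le> (1 + x) ^ n"
proof (cases "k \<le> n")
  case True
  have "real (n choose k) * x ^ k \<le> (\<Sum>i\<le>n. real (n choose i) * x ^ i)"
    by (rule member_le_sum) (use True assms in auto)
  also have "\<dots> = (1 + x) ^ n"
    using binomial_ring[of x 1 n] by (simp add: add.commute)
  finally show ?thesis .
next
  case False
  then show ?thesis using assms by (simp add: binomial_eq_0)
qed

text \<open>
  Enlarging a set by a sixteenth of its size leaves few subsets of the original size: this is
  where the constant $1/16$ of the vertex expansion comes from.
\<close>
lemma choose_slack_le:
  assumes "16 * u \<le> s"
  shows "real ((s + u) choose u) ^ 2 \<le> 2 ^ s"
proof -
  define t where "t = s - 16 * u"
  have s: "s = 16 * u + t" using assms by (simp add: t_def)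
  \<comment> \<open>The bound $(1 + x)^n / x^k$ for $\binom{n}{k}$ is best for $x$ near $k / n$.\<close>
  have "real ((s + u) choose u) * (1/16) ^ u \<le> (17/16) ^ (s + u)"
    using choose_mult_power_le[of "1/16" "s + u" u] by simp
  then have "real ((s + u) choose u) \<le> 16 ^ u * (17/16) ^ (s + u)"
    by (simp add: power_divide field_simps)
  then have "real ((s + u) choose u) ^ 2 \<le> (16 ^ u * (17/16) ^ (s + u)) ^ 2"
    by (intro power_mono) auto
  also have "\<dots> = ((256 * (17/16) ^ 34) ^ u) * ((17/16) ^ 2) ^ t"
  proof -
    have "(17/16 :: real) ^ (s + u) = ((17/16) ^ 17) ^ u * (17/16) ^ t"
      unfolding s power_mult[symmetric] power_add[symmetric] by (simp add: algebra_simps)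
    moreover have "(256 * (17/16 :: real) ^ 34) = (16 * (17/16) ^ 17) ^ 2"
      by (simp add: power_divide)
    ultimately show ?thesis
      by (simp only: power_mult_distrib power_mult[symmetric] mult.commute[of _ 2] mult.assoc)
  qed
  also have "\<dots> \<le> (2 ^ 16) ^ u * 2 ^ t"
    by (intro mult_mono power_mono) (auto simp: power_divide)
  also have "\<dots> = 2 ^ s" by (simp add: s power_add power_mult)
  finally show ?thesis .
qed

lemma two_power_le_choose:
  assumes "2 * s \<le> n"
  shows "2 ^ s \<le> real (n choose s)"
proof (cases "s = 0")
  case False
  have "(2 :: real) \<le> real n / real s" using assms False by (simp add: field_simps)
  then have "2 ^ s \<le> (real n / real s) ^ s" by (intro power_mono) auto
  also have "\<dots> \<le> real (n choose s)" using assms by (intro binomial_ge_n_over_k_pow_k) auto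
  finally show ?thesis .
qed auto

lemma exists_permutes_image_eq:
  assumes "finite A" "V \<subseteq> A" "W \<subseteq> A" "card V = card W"
  shows "\<exists>\<sigma>. \<sigma> permutes A \<and> \<sigma> ` V = W"
proof -
  have fin: "finite V" "finite W" using assms finite_subset by auto
  have "card (A - V) = card (A - W)" using assms fin by (simp add: card_Diff_subset)
  then obtain f g where f: "bij_betw f V W" and g: "bij_betw g (A - V) (A - W)"
    using assms fin by (metis bij_betw_iff_card finite_Diff)
  define \<sigma> where "\<sigma> x = (if x \<in> V then f x else if x \<in> A then g x else x)" for x
  have "bij_betw \<sigma> V W" using f by (rule bij_betw_cong[THEN iffD1, rotated]) (auto simp: \<sigma>_def)
  moreover have "bij_betw \<sigma> (A - V) (A - W)"
    using g by (rule bij_betw_cong[THEN iffD1, rotated]) (auto simp: \<sigma>_def)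
  ultimately have "bij_betw \<sigma> (V \<union> (A - V)) (W \<union> (A - W))"
    by (rule bij_betw_combine) auto
  then have "bij_betw \<sigma> A A" using assms by (simp add: Un_absorb1)
  then have "\<sigma> permutes A"
    by (rule bij_imp_permutes) (use assms in \<open>auto simp: \<sigma>_def\<close>)
  moreover have "\<sigma> ` V = W" using \<open>bij_betw \<sigma> V W\<close> by (simp add: bij_betw_def)
  ultimately show ?thesis by blast
qed

text \<open>
  A uniformly random permutation maps $S$ to a uniformly random set of size $|S|$, so it maps $S$
  into $W$ with probability $\binom{|W|}{|S|} / \binom{|A|}{|S|}$.
\<close>
lemma card_permutes_into:
  assumes A: "finite A" and S: "S \<subseteq> A" and W: "W \<subseteq> A"
  shows "card {\<pi>. \<pi> permutes A \<and> \<pi> ` S \<subseteq> W} * (card A choose card S)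
    = (card W choose card S) * fact (card A)"
proof -
  define q where "q V = card {\<pi>. \<pi> permutes A \<and> \<pi> ` S = V}" for V
  define Vs where "Vs X = {V. V \<subseteq> X \<and> card V = card S}" for X :: "'a set"
  have finP: "finite {\<pi>. \<pi> permutes A \<and> Q \<pi>}" for Q
    by (rule finite_subset[OF _ finite_permutations[OF A]]) auto
  have finVs: "finite (Vs X)" if "finite X" for X
    unfolding Vs_def using that by auto
  have q_le: "q V \<le> q V'" if V: "V \<in> Vs A" "V' \<in> Vs A" for V V'
  proof -
    obtain \<sigma> where \<sigma>: "\<sigma> permutes A" "\<sigma> ` V = V'"
      using exists_permutes_image_eq[OF A, of V V'] V unfolding Vs_def by auto
    have "inj_on (\<lambda>\<pi>. \<sigma> \<circ> \<pi>) {\<pi>. \<pi> permutes A \<and> \<pi> ` S = V}"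
      using permutes_inj[OF \<sigma>(1)] by (auto simp: inj_on_def fun_eq_iff)
    moreover have "(\<lambda>\<pi>. \<sigma> \<circ> \<pi>) ` {\<pi>. \<pi> permutes A \<and> \<pi> ` S = V}
        \<subseteq> {\<pi>. \<pi> permutes A \<and> \<pi> ` S = V'}"
      using \<sigma> by (auto simp: image_comp[symmetric] intro!: permutes_compose)
    ultimately show ?thesis unfolding q_def by (intro card_inj_on_le finP)
  qed
  then have q_eq: "q V = q S" if "V \<in> Vs A" for V
    using that S by (metis (mono_tags, lifting) Vs_def antisym mem_Collect_eq)
  have count: "card {\<pi>. \<pi> permutes A \<and> \<pi> ` S \<subseteq> X} = (card X choose card S) * q S"
    if X: "X \<subseteq> A" for X
  proof -
    have finX: "finite X" using X A finite_subset by auto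
    have "{\<pi>. \<pi> permutes A \<and> \<pi> ` S \<subseteq> X} = (\<Union>V\<in>Vs X. {\<pi>. \<pi> permutes A \<and> \<pi> ` S = V})"
      by (auto simp: Vs_def card_image permutes_inj_on)
    then have "card {\<pi>. \<pi> permutes A \<and> \<pi> ` S \<subseteq> X} = (\<Sum>V\<in>Vs X. q V)"
      unfolding q_def by (simp only:) (rule card_UN_disjoint, use finVs finX finP in auto)
    also have "\<dots> = (\<Sum>V\<in>Vs X. q S)"
      by (rule sum.cong) (use X in \<open>auto intro!: q_eq simp: Vs_def\<close>)
    also have "\<dots> = (card X choose card S) * q S"
      using n_subsets[OF finX, of "card S"] by (simp add: Vs_def)
    finally show ?thesis .
  qed
  have "{\<pi>. \<pi> permutes A \<and> \<pi> ` S \<subseteq> A} = {\<pi>. \<pi> permutes A}"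
    using S by (auto simp: permutes_in_image)
  then have "fact (card A) = (card A choose card S) * q S"
    using count[of A] card_permutations[OF refl A] by simp
  then show ?thesis by (simp add: count[OF W])
qed

text \<open>
  A set $S$ of size $s$ fails to expand under eight permutations if they all map it into
  $S \cup U$ for some $U$ with $u = |U| < s / 16$. For fixed $s$ and $u$ this has probability at
  most $\binom{n}{s} \binom{n}{u} (\binom{s+u}{s} / \binom{n}{s})^8$. As
  $\binom{s+u}{s}^2 \le 2^s \le \binom{n}{s}$ and $\binom{n}{u} \le \binom{n}{s}$, this is at most
  $\binom{n}{s}^{-2} \le n^{-2}$, and there are fewer than $n^2$ pairs $(s, u)$.
\<close>
lemma expanding_permutations_exist:
  assumes A: "finite A"
  shows "\<exists>\<pi>. (\<forall>i<8::nat. \<pi> i permutes A) \<and>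
    (\<forall>S\<subseteq>A. 2 * card S \<le> card A \<longrightarrow> card S \<le> 16 * card ((\<Union>i<8. \<pi> i ` S) - S))"
proof -
  define n where "n = card A"
  define F where "F = (\<Pi>\<^sub>E i\<in>{..<8::nat}. {\<pi>. \<pi> permutes A})"
  define bad where "bad S U = (\<Pi>\<^sub>E i\<in>{..<8::nat}. {\<pi>. \<pi> permutes A \<and> \<pi> ` S \<subseteq> S \<union> U})" for S U
  define sub where "sub k = {S. S \<subseteq> A \<and> card S = k}" for k
  define I where "I = {(s, u). 1 \<le> s \<and> 2 * s \<le> n \<and> 16 * u < s}"
  define Bad where "Bad = (\<Union>z\<in>I. \<Union>S\<in>sub (fst z). \<Union>U\<in>sub (snd z). bad S U)"
  have fin_sub: "finite (sub k)" for k unfolding sub_def using A by auto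
  have card_sub: "card (sub k) = n choose k" for k unfolding sub_def n_def using A by (rule n_subsets)
  have finI: "finite I" and cardI: "card I \<le> (n - 1) * n"
  proof -
    have sub: "I \<subseteq> {1..n - 1} \<times> {..<n}" unfolding I_def by auto
    then show "finite I" by (rule finite_subset) auto
    show "card I \<le> (n - 1) * n" using card_mono[OF _ sub] by (simp add: card_cartesian_product)
  qed
  have cardF: "card F = fact n ^ 8"
    unfolding F_def using card_permutations[OF refl A] by (simp add: card_PiE n_def)
  have term_le: "real n ^ 2 * real (\<Sum>S\<in>sub s. \<Sum>U\<in>sub u. card (bad S U)) \<le> fact n ^ 8"
    if su: "(s, u) \<in> I" for s u
  proof -
    have su': "1 \<le> s" "2 * s \<le> n" "16 * u < s" using su by (auto simp: I_def)
    define c where "c = real (n choose s)"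
    have c1: "real n \<le> c" unfolding c_def using binomial_mono[of 1 s n] su' by simp
    have cpos: "c > 0" using c1 su' by simp
    have cu: "real (n choose u) \<le> c" unfolding c_def using binomial_mono[of u s n] su' by simp
    have single: "card (bad S U) * c ^ 4 \<le> fact n ^ 8" if "S \<in> sub s" "U \<in> sub u" for S U
    proof -
      have SU: "S \<subseteq> A" "U \<subseteq> A" "card S = s" "card U = u" using that by (auto simp: sub_def)
      define m where "m = card {\<pi>. \<pi> permutes A \<and> \<pi> ` S \<subseteq> S \<union> U}"
      have "m * (n choose s) = (card (S \<union> U) choose s) * fact n"
        using card_permutes_into[OF A, of S "S \<union> U"] SU by (simp add: m_def n_def)
      also have "\<dots> \<le> ((s + u) choose s) * fact n"
        using card_Un_le[of S U] SU by (intro mult_right_mono binomial_right_mono) auto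
      also have "(s + u) choose s = (s + u) choose u" by (metis add_diff_cancel_left' binomial_symmetric le_add1)
      finally have "real m * c \<le> real ((s + u) choose u) * fact n"
        unfolding c_def by (metis of_nat_mult of_nat_fact of_nat_le_iff)
      then have "(real m * c) ^ 2 \<le> (real ((s + u) choose u) * fact n) ^ 2"
        by (intro power_mono) (auto simp: c_def)
      also have "\<dots> \<le> c * fact n ^ 2"
        using order.trans[OF choose_slack_le[of u s] two_power_le_choose[of s n]] su'
        unfolding c_def power_mult_distrib by (intro mult_right_mono) simp_all
      finally have "real m ^ 2 * c \<le> fact n ^ 2"
        using cpos by (simp add: power_mult_distrib power2_eq_square)
      then have "(real m ^ 2 * c) ^ 4 \<le> (fact n ^ 2) ^ 4"
        using cpos by (intro power_mono) auto
      moreover have "card (bad S U) = m ^ 8" by (simp add: bad_def m_def card_PiE)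
      ultimately show ?thesis by (simp add: power_mult_distrib flip: power_mult)
    qed
    have "real (\<Sum>S\<in>sub s. \<Sum>U\<in>sub u. card (bad S U)) * c ^ 4
        = (\<Sum>S\<in>sub s. \<Sum>U\<in>sub u. card (bad S U) * c ^ 4)"
      by (simp add: sum_distrib_right)
    also have "\<dots> \<le> (\<Sum>S\<in>sub s. \<Sum>U\<in>sub u. fact n ^ 8)"
      by (intro sum_mono single)
    also have "\<dots> = c * real (n choose u) * fact n ^ 8" by (simp add: card_sub c_def)
    also have "\<dots> \<le> c * c * fact n ^ 8"
      using cu cpos by (intro mult_right_mono mult_left_mono) auto
    finally have "(real (\<Sum>S\<in>sub s. \<Sum>U\<in>sub u. card (bad S U)) * c ^ 2) * c ^ 2 \<le> fact n ^ 8 * c ^ 2"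
      by (simp add: power2_eq_square power4_eq_xxxx mult_ac)
    then have "real (\<Sum>S\<in>sub s. \<Sum>U\<in>sub u. card (bad S U)) * c ^ 2 \<le> fact n ^ 8"
      using cpos by (meson mult_right_le_imp_le zero_less_power)
    moreover have "real (\<Sum>S\<in>sub s. \<Sum>U\<in>sub u. card (bad S U)) * real n ^ 2
        \<le> real (\<Sum>S\<in>sub s. \<Sum>U\<in>sub u. card (bad S U)) * c ^ 2"
      using c1 by (intro mult_left_mono power_mono of_nat_0_le_iff) auto
    ultimately show ?thesis by (simp add: mult.commute)
  qed
  define W where "W z = (\<Sum>S\<in>sub (fst z). \<Sum>U\<in>sub (snd z). card (bad S U))" for z
  have "card Bad < card F"
  proof -
    have "card Bad \<le> (\<Sum>z\<in>I. W z)"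
    proof -
      have "card Bad \<le> (\<Sum>z\<in>I. card (\<Union>S\<in>sub (fst z). \<Union>U\<in>sub (snd z). bad S U))"
        unfolding Bad_def by (rule card_UN_le[OF finI])
      also have "\<dots> \<le> (\<Sum>z\<in>I. W z)"
        unfolding W_def
        by (intro sum_mono order.trans[OF card_UN_le[OF fin_sub]] card_UN_le fin_sub)
      finally show ?thesis .
    qed
    then have "real n ^ 2 * real (card Bad) \<le> real n ^ 2 * real (\<Sum>z\<in>I. W z)"
      by (intro mult_left_mono of_nat_mono) auto
    also have "\<dots> = (\<Sum>z\<in>I. real n ^ 2 * real (W z))"
      by (simp only: sum_distrib_left of_nat_sum)
    also have "\<dots> \<le> (\<Sum>z\<in>I. fact n ^ 8)"
      by (intro sum_mono) (simp only: W_def, rule term_le, simp)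
    also have "\<dots> = real (card I) * fact n ^ 8" by simp
    also have "\<dots> \<le> real ((n - 1) * n) * fact n ^ 8"
      using cardI by (intro mult_right_mono of_nat_mono) auto
    finally have main: "real n ^ 2 * real (card Bad) \<le> real ((n - 1) * n) * fact n ^ 8" .
    show ?thesis
    proof (cases "n = 0")
      case True
      then have "I = {}" by (auto simp: I_def)
      then show ?thesis by (simp add: Bad_def cardF)
    next
      case False
      then have "real ((n - 1) * n) < real n ^ 2" by (simp add: power2_eq_square)
      then have "real ((n - 1) * n) * fact n ^ 8 < real n ^ 2 * fact n ^ 8"
        by (intro mult_strict_right_mono) auto
      with main have "real (card Bad) < fact n ^ 8"
        by (meson mult_less_cancel_left_disj order.strict_trans1 zero_le_power2 not_less)
      then have "real (card Bad) < real (fact n ^ 8)" by simp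
      then show ?thesis
        unfolding cardF by (simp only: of_nat_less_iff)
    qed
  qed
  moreover have "finite F" unfolding F_def using finite_permutations[OF A] by (auto intro: finite_PiE)
  moreover have "Bad \<subseteq> F" unfolding Bad_def bad_def F_def by (auto simp: PiE_iff)
  ultimately obtain \<pi> where \<pi>: "\<pi> \<in> F" "\<pi> \<notin> Bad"
    using psubset_imp_ex_mem[of Bad F] by blast
  have perm: "\<pi> i permutes A" if "i < 8" for i using \<pi>(1) that by (auto simp: F_def PiE_iff)
  have "card S \<le> 16 * card ((\<Union>i<8. \<pi> i ` S) - S)" if S: "S \<subseteq> A" "2 * card S \<le> card A" for S
  proof (rule ccontr)
    assume less: "\<not> ?thesis"
    define U where "U = (\<Union>i<8. \<pi> i ` S) - S"
    have "U \<subseteq> A"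
    proof
      fix y assume "y \<in> U"
      then obtain i x where "i < 8" "x \<in> S" "y = \<pi> i x" by (auto simp: U_def)
      then show "y \<in> A" using permutes_in_image[OF perm, of i x] S by auto
    qed
    then have "\<pi> \<in> bad S U" using \<pi>(1) unfolding bad_def F_def U_def by (auto simp: PiE_iff)
    moreover have "(card S, card U) \<in> I" using less S by (auto simp: I_def U_def n_def)
    moreover have "S \<in> sub (card S)" "U \<in> sub (card U)" using S \<open>U \<subseteq> A\<close> by (auto simp: sub_def)
    ultimately have "\<pi> \<in> Bad" unfolding Bad_def by (intro UN_I[of "(card S, card U)"]) auto
    then show False using \<pi>(2) by simp
  qed
  then show ?thesis using perm by (intro exI[of _ \<pi>]) auto
qed

lemma vertex_expander_exists:
  assumes A: "finite (A :: 'a set)"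
  shows "\<exists>R. R \<subseteq> A \<times> A \<and> sym R \<and> irrefl R \<and> (\<forall>x. card (R `` {x}) \<le> 16) \<and>
    (\<forall>S\<subseteq>A. 2 * card S \<le> card A \<longrightarrow> card S \<le> 16 * card (R `` S - S))"
proof -
  obtain \<pi> where perm: "\<And>i. i < 8 \<Longrightarrow> \<pi> i permutes A"
    and exp: "\<And>S. S \<subseteq> A \<Longrightarrow> 2 * card S \<le> card A \<Longrightarrow>
      card S \<le> 16 * card ((\<Union>i<8::nat. \<pi> i ` S) - S)"
    using expanding_permutations_exist[OF A] by blast
  define R where "R = {(x, y). x \<in> A \<and> y \<in> A \<and> x \<noteq> y \<and> (\<exists>i<8::nat. y = \<pi> i x \<or> x = \<pi> i y)}"
  have "card (R `` {x}) \<le> 16" for x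
  proof -
    have "R `` {x} \<subseteq> (\<lambda>i. \<pi> i x) ` {..<8} \<union> (\<lambda>i. inv (\<pi> i) x) ` {..<8}"
    proof
      fix y assume "y \<in> R `` {x}"
      then obtain i where "i < 8" and "y = \<pi> i x \<or> x = \<pi> i y" by (auto simp: R_def)
      from this(2) show "y \<in> (\<lambda>i. \<pi> i x) ` {..<8} \<union> (\<lambda>i. inv (\<pi> i) x) ` {..<8}"
      proof (elim disjE)
        assume "y = \<pi> i x"
        then show ?thesis using \<open>i < 8\<close> by auto
      next
        assume "x = \<pi> i y"
        then have "y = inv (\<pi> i) x" using permutes_inverses(2)[OF perm] \<open>i < 8\<close> by simp
        then show ?thesis using \<open>i < 8\<close> by (intro UnI2 image_eqI[of _ _ i]) auto
      qed
    qed
    then have "card (R `` {x}) \<le> card ((\<lambda>i. \<pi> i x) ` {..<8} \<union> (\<lambda>i. inv (\<pi> i) x) ` {..<8})"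
      by (intro card_mono) auto
    also have "\<dots> \<le> card ((\<lambda>i. \<pi> i x) ` {..<8}) + card ((\<lambda>i. inv (\<pi> i) x) ` {..<8})"
      by (rule card_Un_le)
    also have "\<dots> \<le> card {..<8::nat} + card {..<8::nat}" by (intro add_mono card_image_le) auto
    finally show ?thesis by simp
  qed
  moreover have "card S \<le> 16 * card (R `` S - S)" if S: "S \<subseteq> A" "2 * card S \<le> card A" for S
  proof -
    have "(\<Union>i<8. \<pi> i ` S) - S \<subseteq> R `` S - S"
    proof
      fix y assume y: "y \<in> (\<Union>i<8. \<pi> i ` S) - S"
      then obtain i x where ix: "i < 8" "x \<in> S" "y = \<pi> i x" by auto
      then have "y \<in> A" using permutes_in_image[OF perm, of i x] S by auto
      then have "(x, y) \<in> R" using ix y S by (auto simp: R_def)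
      then show "y \<in> R `` S - S" using ix y by auto
    qed
    moreover have "finite (R `` S - S)" by (rule finite_subset[OF _ A]) (auto simp: R_def)
    ultimately have "card ((\<Union>i<8. \<pi> i ` S) - S) \<le> card (R `` S - S)" by (intro card_mono)
    then show ?thesis using exp[OF S] by linarith
  qed
  moreover have "R \<subseteq> A \<times> A" "sym R" "irrefl R" by (auto simp: R_def sym_def irrefl_def)
  ultimately show ?thesis by blast
qed

text \<open>Balls in a vertex expander grow geometrically until they contain more than half of it,
  and two sets of that size meet.\<close>
lemma expander_relpow_bound:
  assumes A: "finite A" and R: "R \<subseteq> A \<times> A" "sym R"
    and exp: "\<And>S. S \<subseteq> A \<Longrightarrow> 2 * card S \<le> card A \<Longrightarrow> card S \<le> 16 * card (R `` S - S)"
    and r: "real (card A) < 2 * (17/16) ^ r" and xy: "x \<in> A" "y \<in> A"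
  shows "\<exists>k\<le>2 * r. (x, y) \<in> R ^^ k"
proof -
  define N where "N x k = {z. \<exists>j\<le>k. (x, z) \<in> R ^^ j}" for x k
  have N_sub: "N x k \<subseteq> A" if "x \<in> A" for x k
  proof -
    have "z \<in> A" if "(x, z) \<in> R ^^ j" for z j
      using that \<open>x \<in> A\<close> R(1) by (cases j) auto
    then show ?thesis by (auto simp: N_def)
  qed
  have large: "card A < 2 * card (N x r)" if x: "x \<in> A" for x
  proof -
    have "(17/16) ^ k \<le> real (card (N x k)) \<or> card A < 2 * card (N x k)" for k
    proof (induction k)
      case 0
      have "N x 0 = {x}" by (auto simp: N_def)
      then show ?case by simp
    next
      case (Suc k)
      have fin: "finite (N x k)" "finite (N x (Suc k))" by (rule finite_subset[OF N_sub[OF x] A])+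
      have mono: "N x k \<subseteq> N x (Suc k)" by (auto simp: N_def intro: le_SucI)
      show ?case
      proof (cases "card A < 2 * card (N x k)")
        case True
        then show ?thesis using card_mono[OF fin(2) mono] by linarith
      next
        case False
        have "R `` N x k \<subseteq> N x (Suc k)"
          unfolding N_def by (force intro: relpow_Suc_I)
        then have "card (N x k \<union> (R `` N x k - N x k)) \<le> card (N x (Suc k))"
          using mono by (intro card_mono fin) auto
        moreover have "finite (R `` N x k - N x k)" by (rule finite_subset[OF _ A]) (use R in auto)
        ultimately have "card (N x k) + card (R `` N x k - N x k) \<le> card (N x (Suc k))"
          using fin by (subst (asm) card_Un_disjoint) auto
        moreover have "card (N x k) \<le> 16 * card (R `` N x k - N x k)"
          using False by (intro exp N_sub x) auto
        ultimately have "17/16 * real (card (N x k)) \<le> real (card (N x (Suc k)))" by linarith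
        moreover have "(17/16) ^ k \<le> real (card (N x k))" using Suc False by blast
        ultimately show ?thesis by simp
      qed
    qed
    then show ?thesis using r by (metis of_nat_less_iff of_nat_mult of_nat_numeral linorder_not_le
        mult_left_mono order.strict_trans2 zero_le_numeral)
  qed
  have "N x r \<inter> N y r \<noteq> {}"
  proof
    assume "N x r \<inter> N y r = {}"
    then have "card (N x r) + card (N y r) = card (N x r \<union> N y r)"
      using finite_subset[OF N_sub[OF xy(1)] A] finite_subset[OF N_sub[OF xy(2)] A]
      by (subst card_Un_disjoint) auto
    also have "\<dots> \<le> card A" using N_sub xy by (intro card_mono A) auto
    finally show False using large[OF xy(1)] large[OF xy(2)] by linarith
  qed
  then obtain z i j where z: "i \<le> r" "(x, z) \<in> R ^^ i" "j \<le> r" "(y, z) \<in> R ^^ j"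
    by (auto simp: N_def)
  have "(z, y) \<in> R ^^ j" using z(4)
  proof (induction j arbitrary: z)
    case (Suc j)
    then show ?case using R(2) by (metis relpow_Suc_E relpow_Suc_I2 symD)
  qed auto
  then have "(x, y) \<in> R ^^ (i + j)" using z by (auto simp: relpow_add)
  then show ?thesis using z by (intro exI[of _ "i + j"]) auto
qed


section \<open>Distances and components\<close>

lemma sym_adj: "sym (adj G)"
  by (auto simp: adj_def sym_def insert_commute)

text \<open>Distance at most $k$, in a form that also makes sense before the graph is known to be
  connected; \<open>gdist\<close> says nothing about vertices in different components.\<close>
definition near :: "'a ugraph \<Rightarrow> nat \<Rightarrow> 'a \<Rightarrow> 'a \<Rightarrow> bool" where
  "near G k x y \<longleftrightarrow> (\<exists>j\<le>k. (x, y) \<in> adj G ^^ j)"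

lemma near_refl: "near G k x x"
  unfolding near_def by (rule exI[of _ 0]) auto

lemma near_adj: "{x, y} \<in> edges G \<Longrightarrow> near G 1 x y"
  unfolding near_def by (rule exI[of _ 1]) (auto simp: adj_def)

lemma near_mono: "near G k x y \<Longrightarrow> k \<le> l \<Longrightarrow> near G l x y"
  unfolding near_def using le_trans by blast

lemma near_trans: "near G k x y \<Longrightarrow> near G l y z \<Longrightarrow> near G (k + l) x z"
  unfolding near_def by (metis add_mono relpow_add relcomp.relcompI)

lemma near_sym: "near G k x y \<Longrightarrow> near G k y x"
proof -
  have "(y, x) \<in> adj G ^^ j" if "(x, y) \<in> adj G ^^ j" for j
    using that
  proof (induction j arbitrary: y)
    case (Suc j)
    then obtain z where "(x, z) \<in> adj G ^^ j" "(z, y) \<in> adj G" by auto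
    then show ?case using Suc.IH sym_adj[of G] by (metis relpow_Suc_I2 symD)
  qed simp
  then show "near G k x y \<Longrightarrow> near G k y x" unfolding near_def by blast
qed

lemma finite_gdist_set:
  "finite (verts G) \<Longrightarrow> finite {gdist G x y | x y. x \<in> verts G \<and> y \<in> verts G}"
  by (rule finite_subset[of _ "(\<lambda>(x, y). gdist G x y) ` (verts G \<times> verts G)"]) auto

lemma diam_le:
  assumes "finite (verts G)" "verts G \<noteq> {}"
    and "\<And>x y. x \<in> verts G \<Longrightarrow> y \<in> verts G \<Longrightarrow> near G k x y"
  shows "diam G \<le> k"
proof -
  have "gdist G x y \<le> k" if "x \<in> verts G" "y \<in> verts G" for x y
    using assms(3)[OF that] unfolding gdist_def near_def by (meson Least_le le_trans)
  moreover obtain x where "x \<in> verts G" using assms(2) by blast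
  ultimately show ?thesis
    unfolding diam_def using finite_gdist_set[OF assms(1)] by (subst Max_le_iff) auto
qed

lemma adj_relpow_potential_le:
  fixes f :: "'a \<Rightarrow> nat"
  assumes "\<And>x y. {x, y} \<in> edges G \<Longrightarrow> f y \<le> f x + 1"
    and "(x, y) \<in> adj G ^^ k"
  shows "f y \<le> f x + k"
  using assms(2)
proof (induction k arbitrary: y)
  case (Suc k)
  then obtain z where z: "(x, z) \<in> adj G ^^ k" "(z, y) \<in> adj G" by auto
  then have "f y \<le> f z + 1" using assms(1) by (auto simp: adj_def)
  then show ?case using Suc.IH[OF z(1)] by linarith
qed simp

text \<open>A function that changes by at most one along edges bounds distances from below.\<close>
lemma diam_component_ge:
  fixes f :: "'a \<Rightarrow> nat"
  assumes fin: "finite (verts G)"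
    and lip: "\<And>x y. {x, y} \<in> edges G \<Longrightarrow> f y \<le> f x + 1"
    and edges: "\<And>e. e \<in> edges G \<Longrightarrow> e \<subseteq> verts G"
    and v: "v \<in> verts G" and vz: "(v, z) \<in> (adj G)\<^sup>*"
  shows "f z \<le> f v + diam (component G v)"
proof -
  define C where "C = {w \<in> verts G. (v, w) \<in> (adj G)\<^sup>*}"
  have comp: "component G v = \<lparr>verts = C, edges = {e \<in> edges G. e \<subseteq> C}\<rparr>"
    by (simp add: component_def C_def Let_def)
  let ?H = "component G v"
  have in_C: "w \<in> C \<and> (v, w) \<in> (adj ?H)\<^sup>*" if "(v, w) \<in> (adj G)\<^sup>*" for w
    using that
  proof (induction rule: rtrancl_induct)
    case base
    then show ?case using v by (auto simp: C_def)
  next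
    case (step y w)
    then have "w \<in> C"
      using edges[of "{y, w}"] rtrancl_into_rtrancl[of v y "adj G" w] by (auto simp: C_def adj_def)
    then have "(y, w) \<in> adj ?H" using step by (auto simp: adj_def comp)
    then show ?case using step \<open>w \<in> C\<close> by auto
  qed
  then have z: "z \<in> C" "(v, z) \<in> (adj ?H)\<^sup>*" using vz by auto
  have "v \<in> C" using in_C[of v] by simp
  have fC: "finite (verts ?H)" using fin by (simp add: comp C_def)
  obtain k where "(v, z) \<in> adj ?H ^^ k" using z(2) rtrancl_imp_relpow by metis
  then have "(v, z) \<in> adj ?H ^^ gdist ?H v z" unfolding gdist_def by (rule LeastI)
  then have "f z \<le> f v + gdist ?H v z"
    by (rule adj_relpow_potential_le[rotated]) (use lip in \<open>auto simp: comp\<close>)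
  also have "gdist ?H v z \<le> diam ?H"
    unfolding diam_def
    by (rule Max_ge[OF finite_gdist_set[OF fC]]) (use z \<open>v \<in> C\<close> in \<open>auto simp: comp\<close>)
  finally show ?thesis by simp
qed

lemma component_subset_closed:
  assumes "w \<in> Z" and "\<And>x y. x \<in> Z \<Longrightarrow> {x, y} \<in> edges G \<Longrightarrow> y \<in> Z"
  shows "verts (component G w) \<subseteq> Z"
proof
  fix z assume "z \<in> verts (component G w)"
  then have "(w, z) \<in> (adj G)\<^sup>*" by (simp add: component_def Let_def)
  then show "z \<in> Z"
    by (induction rule: rtrancl_induct) (use assms in \<open>auto simp: adj_def\<close>)
qed

text \<open>A shortest path does not revisit vertices, and so reaching a vertex only by paths of
  length at least $r$ takes a simple path of length exactly $r$.\<close>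
lemma rtrancl_simple_path:
  assumes "(x, y) \<in> R\<^sup>*"
  shows "(\<exists>k<r. (x, y) \<in> R ^^ k) \<or>
    (\<exists>f. f 0 = x \<and> inj_on f {..r} \<and> (\<forall>i<r. (f i, f (Suc i)) \<in> R))"
proof -
  define k where "k = (LEAST k. (x, y) \<in> R ^^ k)"
  have k: "(x, y) \<in> R ^^ k"
    unfolding k_def using rtrancl_imp_relpow[OF assms] by (metis LeastI)
  have least: "k \<le> j" if "(x, y) \<in> R ^^ j" for j
    unfolding k_def using that by (rule Least_le)
  obtain f where f: "f 0 = x" "f k = y" "\<And>i. i < k \<Longrightarrow> (f i, f (Suc i)) \<in> R"
    using k by (auto simp: relpow_fun_conv)
  have seg: "(f i, f j) \<in> R ^^ (j - i)" if "i \<le> j" "j \<le> k" for i j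
    unfolding relpow_fun_conv
    by (rule exI[of _ "\<lambda>t. f (i + t)"]) (use that f(3) in auto)
  have "f i \<noteq> f j" if "i < j" "j \<le> k" for i j
  proof
    assume "f i = f j"
    then have "(x, y) \<in> R ^^ (i + (k - j))"
      using seg[of 0 i] seg[of j k] that f unfolding relpow_add by auto
    from least[OF this] that show False by linarith
  qed
  then have inj: "inj_on f {..k}" by (metis atMost_iff inj_onI linorder_neqE_nat)
  show ?thesis
  proof (cases "k < r")
    case True
    then show ?thesis using k by blast
  next
    case False
    then have "inj_on f {..r}" using inj_on_subset[OF inj, of "{..r}"] by auto
    then show ?thesis using f False by (intro disjI2 exI[of _ f]) auto
  qed
qed

section \<open>Independent edges\<close>

text \<open>An event about random subsets of edges is a predicate on their indicator functions. Events
  that only look at disjoint sets of edges are independent.\<close>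
definition depends_on :: "'a set \<Rightarrow> (('a \<Rightarrow> bool) \<Rightarrow> bool) \<Rightarrow> bool" where
  "depends_on A P \<longleftrightarrow> (\<forall>\<omega> \<omega>'. (\<forall>a\<in>A. \<omega> a = \<omega>' a) \<longrightarrow> P \<omega> = P \<omega>')"

lemma depends_on_mono: "depends_on A P \<Longrightarrow> A \<subseteq> B \<Longrightarrow> depends_on B P"
  unfolding depends_on_def by blast

lemma depends_on_not: "depends_on A P \<Longrightarrow> depends_on A (\<lambda>\<omega>. \<not> P \<omega>)"
  unfolding depends_on_def by blast

lemma depends_on_all:
  fixes A :: "'i \<Rightarrow> 'a set"
  assumes "\<And>i. i \<in> I \<Longrightarrow> depends_on (A i) (P i)"
  shows "depends_on (\<Union>i\<in>I. A i) (\<lambda>\<omega>. \<forall>i\<in>I. P i \<omega>)"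
  unfolding depends_on_def
proof (intro allI impI ball_cong refl)
  fix \<omega> \<omega>' :: "'a \<Rightarrow> bool" and i
  assume "\<forall>a\<in>\<Union>i\<in>I. A i. \<omega> a = \<omega>' a" "i \<in> I"
  then show "P i \<omega> = P i \<omega>'" using assms[of i] unfolding depends_on_def by blast
qed

lemma depends_on_ex:
  fixes A :: "'i \<Rightarrow> 'a set"
  assumes "\<And>i. i \<in> I \<Longrightarrow> depends_on (A i) (P i)"
  shows "depends_on (\<Union>i\<in>I. A i) (\<lambda>\<omega>. \<exists>i\<in>I. P i \<omega>)"
proof -
  have "depends_on (\<Union>i\<in>I. A i) (\<lambda>\<omega>. \<forall>i\<in>I. \<not> P i \<omega>)"
    by (intro depends_on_all depends_on_not assms)
  from depends_on_not[OF this] show ?thesis by simp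
qed

lemma depends_on_conj:
  assumes "depends_on A P" "depends_on B Q"
  shows "depends_on (A \<union> B) (\<lambda>\<omega>. P \<omega> \<and> Q \<omega>)"
  unfolding depends_on_def
proof (intro allI impI)
  fix \<omega> \<omega>' :: "'a \<Rightarrow> bool"
  assume "\<forall>a\<in>A \<union> B. \<omega> a = \<omega>' a"
  then have "P \<omega> = P \<omega>'" "Q \<omega> = Q \<omega>'" using assms unfolding depends_on_def by blast+
  then show "(P \<omega> \<and> Q \<omega>) = (P \<omega>' \<and> Q \<omega>')" by simp
qed

lemma prob_Collect_not:
  "measure_pmf.prob M {x. \<not> P x} = 1 - measure_pmf.prob M {x. P x}"
proof -
  have "{x. \<not> P x} = space (measure_pmf M) - {x. P x}" by auto
  then show ?thesis by (simp only: measure_pmf.prob_compl sets_measure_pmf UNIV_I)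
qed

lemma prob_conj_independent:
  fixes q :: "'a \<Rightarrow> bool pmf"
  assumes fin: "finite I" and "A \<inter> B = {}" and P: "depends_on A P" and Q: "depends_on B Q"
  defines "M \<equiv> Pi_pmf I False q"
  shows "measure_pmf.prob M {\<omega>. P \<omega> \<and> Q \<omega>}
    = measure_pmf.prob M {\<omega>. P \<omega>} * measure_pmf.prob M {\<omega>. Q \<omega>}"
proof -
  define J K where "J = I \<inter> A" and "K = I - A"
  define N where "N = pair_pmf (Pi_pmf J False q) (Pi_pmf K False q)"
  define h where "h = (\<lambda>(f, g) x. if x \<in> J then f x else g x :: bool)"
  have JK: "finite J" "finite K" "J \<inter> K = {}" "I = J \<union> K" using fin by (auto simp: J_def K_def)
  have M: "M = map_pmf h N"
    unfolding M_def N_def h_def JK(4) using JK by (subst Pi_pmf_union) auto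
  have supp: "\<And>x. x \<notin> J \<Longrightarrow> \<not> f x" "\<And>x. x \<notin> K \<Longrightarrow> \<not> g x" if "(f, g) \<in> set_pmf N" for f g
    using that set_Pi_pmf_subset[OF JK(1), of False q] set_Pi_pmf_subset[OF JK(2), of False q]
    unfolding N_def by auto
  have Ph: "P (h z) = P (fst z)" if "z \<in> set_pmf N" for z
  proof -
    obtain f g where z: "z = (f, g)" by force
    have "h z a = f a" if "a \<in> A" for a
      using supp[of f g] \<open>z \<in> set_pmf N\<close> that by (auto simp: z h_def J_def K_def)
    then show ?thesis using P z unfolding depends_on_def by auto
  qed
  have Qh: "Q (h z) = Q (snd z)" if "z \<in> set_pmf N" for z
  proof -
    obtain f g where z: "z = (f, g)" by force
    have "h z a = g a" if "a \<in> B" for a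
      using \<open>A \<inter> B = {}\<close> that by (auto simp: z h_def J_def)
    then show ?thesis using Q z unfolding depends_on_def by auto
  qed
  have MN: "measure_pmf.prob M {\<omega>. R \<omega>} = measure_pmf.prob N {z. R (h z)}" for R
    unfolding M by (simp add: vimage_def)
  have cong: "measure_pmf.prob N {z. R z} = measure_pmf.prob N {z. R' z}"
    if "\<And>z. z \<in> set_pmf N \<Longrightarrow> R z = R' z" for R R'
    using that by (intro measure_pmf.finite_measure_eq_AE) (auto simp: AE_measure_pmf_iff)
  have fst: "measure_pmf.prob N {z. R (fst z)} = measure_pmf.prob (Pi_pmf J False q) {f. R f}" for R
    using measure_map_pmf[of fst N "{f. R f}"] by (simp add: N_def map_fst_pair_pmf vimage_def)
  have snd: "measure_pmf.prob N {z. R (snd z)} = measure_pmf.prob (Pi_pmf K False q) {f. R f}" for R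
    using measure_map_pmf[of snd N "{f. R f}"] by (simp add: N_def map_snd_pair_pmf vimage_def)
  have fin_set: "finite (set_pmf (Pi_pmf L False q))" if "finite L" for L
  proof (rule finite_subset)
    show "set_pmf (Pi_pmf L False q) \<subseteq> PiE_dflt L False (\<lambda>_. UNIV)"
      using set_Pi_pmf_subset[OF that, of False q] by (auto simp: PiE_dflt_def)
  qed (use that in auto)
  define X where "X = {f. P f} \<inter> set_pmf (Pi_pmf J False q)"
  define Y where "Y = {f. Q f} \<inter> set_pmf (Pi_pmf K False q)"
  have "measure_pmf.prob M {\<omega>. P \<omega> \<and> Q \<omega>} = measure_pmf.prob N {z. z \<in> X \<times> Y}"
    unfolding MN by (rule cong) (use Ph Qh in \<open>auto simp: X_def Y_def N_def\<close>)
  also have "\<dots> = measure_pmf.prob (Pi_pmf J False q) X * measure_pmf.prob (Pi_pmf K False q) Y"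
    unfolding N_def Collect_mem_eq using fin_set JK
    by (intro measure_pmf_prob_product) (auto simp: X_def Y_def intro!: countable_finite)
  also have "\<dots> = measure_pmf.prob (Pi_pmf J False q) {f. P f} * measure_pmf.prob (Pi_pmf K False q) {f. Q f}"
    by (simp add: X_def Y_def measure_Int_set_pmf)
  also have "\<dots> = measure_pmf.prob M {\<omega>. P \<omega>} * measure_pmf.prob M {\<omega>. Q \<omega>}"
    unfolding MN using cong[of "\<lambda>z. P (h z)" "\<lambda>z. P (fst z)"] cong[of "\<lambda>z. Q (h z)" "\<lambda>z. Q (snd z)"]
      Ph Qh by (simp add: fst snd)
  finally show ?thesis .
qed

lemma prob_all_independent:
  fixes q :: "'a \<Rightarrow> bool pmf"
  assumes fin: "finite I" and "finite J" and dep: "\<And>i. i \<in> J \<Longrightarrow> depends_on (A i) (P i)"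
    and disj: "disjoint_family_on A J"
  defines "M \<equiv> Pi_pmf I False q"
  shows "measure_pmf.prob M {\<omega>. \<forall>i\<in>J. P i \<omega>} = (\<Prod>i\<in>J. measure_pmf.prob M {\<omega>. P i \<omega>})"
  using assms(2-4)
proof (induction J rule: finite_induct)
  case (insert j J)
  have "measure_pmf.prob M {\<omega>. P j \<omega> \<and> (\<forall>i\<in>J. P i \<omega>)}
      = measure_pmf.prob M {\<omega>. P j \<omega>} * measure_pmf.prob M {\<omega>. \<forall>i\<in>J. P i \<omega>}"
    unfolding M_def
  proof (rule prob_conj_independent[OF fin])
    show "A j \<inter> (\<Union>i\<in>J. A i) = {}"
    proof -
      have "A j \<inter> A i = {}" if "i \<in> J" for i
        using disjoint_family_onD[OF insert.prems(2), of j i] insert.hyps(2) that by blast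
      then show ?thesis by blast
    qed
    show "depends_on (A j) (P j)" by (rule insert.prems(1)) simp
    show "depends_on (\<Union>i\<in>J. A i) (\<lambda>\<omega>. \<forall>i\<in>J. P i \<omega>)"
      by (rule depends_on_all, rule insert.prems(1)) simp
  qed
  moreover have "measure_pmf.prob M {\<omega>. \<forall>i\<in>J. P i \<omega>} = (\<Prod>i\<in>J. measure_pmf.prob M {\<omega>. P i \<omega>})"
  proof (rule insert.IH)
    show "disjoint_family_on A J"
      by (rule disjoint_family_on_mono[OF _ insert.prems(2)]) auto
  qed (rule insert.prems(1), simp)
  ultimately show ?case using insert.hyps by simp
qed simp

lemma prob_all_open:
  assumes "finite I" "A \<subseteq> I" "0 \<le> p" "p \<le> 1"
  shows "measure_pmf.prob (Pi_pmf I False (\<lambda>_. bernoulli_pmf p)) {\<omega>. \<forall>a\<in>A. \<omega> a} = p ^ card A"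
proof -
  have "{\<omega>. \<forall>a\<in>A. \<omega> a} = Pi I (\<lambda>a. if a \<in> A then {True} else UNIV)"
    using assms(2) by (auto simp: Pi_def)
  then have "measure_pmf.prob (Pi_pmf I False (\<lambda>_. bernoulli_pmf p)) {\<omega>. \<forall>a\<in>A. \<omega> a}
      = (\<Prod>a\<in>I. measure_pmf.prob (bernoulli_pmf p) (if a \<in> A then {True} else UNIV))"
    using assms(1) by (simp add: measure_Pi_pmf_Pi)
  also have "\<dots> = (\<Prod>a\<in>I. if a \<in> A then p else 1)"
    using assms by (intro prod.cong) (auto simp: measure_pmf_single)
  also have "\<dots> = p ^ card A"
    using assms by (simp add: prod.If_cases Int_absorb1)
  finally show ?thesis .
qed

definition open_subgraph :: "'a ugraph \<Rightarrow> ('a set \<Rightarrow> bool) \<Rightarrow> 'a ugraph" where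
  "open_subgraph G \<omega> = \<lparr>verts = verts G, edges = {e \<in> edges G. \<omega> e}\<rparr>"

lemma prob_percolation:
  "measure_pmf.prob (percolation G p) {H. P H}
    = measure_pmf.prob (Pi_pmf (edges G) False (\<lambda>_. bernoulli_pmf p)) {\<omega>. P (open_subgraph G \<omega>)}"
  by (simp add: percolation_def open_subgraph_def vimage_def)


section \<open>Replacing edges by chains of parallel paths\<close>

text \<open>Vertices are coded as natural numbers. The second component tells hubs from the vertices
  inside the chain of an edge $(x, y)$, where $y > x \ge 0$; the last one tells the joints of a chain
  from the middle vertices of its paths of length two.\<close>
definition hub :: "nat \<Rightarrow> nat" where
  "hub x = to_nat (x, 0::nat, 0::nat, 0::nat)"

lemma hub_eq_iff [simp]: "hub x = hub y \<longleftrightarrow> x = y"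
  by (simp add: hub_def)

text \<open>
  Every edge $e = (x, y)$ of a base graph becomes a chain of \<open>len e\<close> bundles between consecutive
  joints, from the hub of $x$ to the hub of $y$; a bundle consists of \<open>wid e\<close> parallel paths of
  length two. For every $p$ strictly between 0 and 1, long chains of width one hardly ever let
  percolation pass, whereas wide enough chains of a given length almost always do.
\<close>
locale chain_graph =
  fixes B :: "nat set" and E :: "(nat \<times> nat) set" and len wid :: "nat \<times> nat \<Rightarrow> nat"
  assumes finite_B: "finite B"
    and E_base: "e \<in> E \<Longrightarrow> fst e \<in> B \<and> snd e \<in> B \<and> fst e < snd e"
    and len_pos: "0 < len e" and wid_pos: "0 < wid e"
begin

definition joint :: "nat \<times> nat \<Rightarrow> nat \<Rightarrow> nat" where
  "joint e j = (if j = 0 then hub (fst e) else if j = len e then hub (snd e)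
     else to_nat (fst e, snd e, j, 0::nat))"

definition mid :: "nat \<times> nat \<Rightarrow> nat \<Rightarrow> nat \<Rightarrow> nat" where
  "mid e j i = to_nat (fst e, snd e, j, Suc i)"

text \<open>The index $b \in \{0, 1\}$ tells the two halves of a path of length two apart.\<close>
definition link :: "nat \<times> nat \<Rightarrow> nat \<Rightarrow> nat \<Rightarrow> nat \<Rightarrow> nat set" where
  "link e j i b = {joint e (j + b), mid e j i}"

definition links :: "nat \<times> nat \<Rightarrow> nat set set" where
  "links e = (\<lambda>(j, i, b). link e j i b) ` ({..<len e} \<times> {..<wid e} \<times> {..<2})"

definition inner :: "nat \<times> nat \<Rightarrow> nat set" where
  "inner e = joint e ` {0<..<len e} \<union> (\<lambda>(j, i). mid e j i) ` ({..<len e} \<times> {..<wid e})"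

definition G :: "nat ugraph" where
  "G = \<lparr>verts = hub ` B \<union> (\<Union>e\<in>E. inner e), edges = (\<Union>e\<in>E. links e)\<rparr>"

lemma verts_G: "verts G = hub ` B \<union> (\<Union>e\<in>E. inner e)" and edges_G: "edges G = (\<Union>e\<in>E. links e)"
  by (simp_all add: G_def)

lemma finite_E: "finite E"
  by (rule finite_subset[of _ "B \<times> B"]) (use E_base finite_B in auto)

lemma joint_0 [simp]: "joint e 0 = hub (fst e)" and joint_len [simp]: "joint e (len e) = hub (snd e)"
  using len_pos[of e] by (auto simp: joint_def)

lemma mid_eq_iff [simp]: "mid e j i = mid e' j' i' \<longleftrightarrow> e = e' \<and> j = j' \<and> i = i'"
  by (auto simp: mid_def prod_eq_iff)

lemma mid_neq_joint [simp]: "mid e j i \<noteq> joint e' j'" "joint e' j' \<noteq> mid e j i"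
  by (auto simp: mid_def joint_def hub_def)

lemma mid_neq_hub [simp]: "mid e j i \<noteq> hub x" "hub x \<noteq> mid e j i"
  by (auto simp: mid_def hub_def)

lemma joint_eq_iff:
  assumes "e \<in> E" "j \<le> len e" "j' \<le> len e"
  shows "joint e j = joint e j' \<longleftrightarrow> j = j'"
  using E_base[OF assms(1)] assms(2,3) by (auto simp: joint_def hub_def)

lemma joint_inner:
  assumes "e \<in> E" "0 < j" "j < len e"
  shows "joint e j \<noteq> hub x" and "joint e j = joint e' j' \<longleftrightarrow> e' = e \<and> j' = j"
proof -
  show "joint e j \<noteq> hub x"
    using E_base[OF assms(1)] assms(2,3) by (auto simp: joint_def hub_def)
  have "e' = e \<and> j' = j" if "joint e j = joint e' j'"
  proof -
    have "fst e' = fst e \<and> snd e' = snd e \<and> j' = j"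
      using that E_base[OF assms(1)] assms(2,3) by (auto simp: joint_def hub_def split: if_splits)
    then show ?thesis by (simp add: prod_eq_iff)
  qed
  then show "joint e j = joint e' j' \<longleftrightarrow> e' = e \<and> j' = j" by blast
qed

lemma hub_notin_inner [simp]: "e \<in> E \<Longrightarrow> hub x \<notin> inner e"
  using joint_inner(1)[of e _ x] by (auto simp: inner_def) metis

lemma inner_disjoint:
  assumes "e \<in> E" "e' \<in> E" "z \<in> inner e" "z \<in> inner e'"
  shows "e = e'"
proof (cases "\<exists>j. 0 < j \<and> j < len e \<and> z = joint e j")
  case True
  then obtain j where j: "0 < j" "j < len e" "z = joint e j" by blast
  then obtain j' where "z = joint e' j'" using assms(4) by (auto simp: inner_def)
  then show ?thesis using joint_inner(2)[OF assms(1) j(1,2), of e' j'] j(3) by auto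
next
  case False
  then show ?thesis using assms(3,4) by (auto simp: inner_def)
qed

lemma link_eq_iff:
  assumes "e \<in> E" "e' \<in> E" "j < len e" "j' < len e'" "b < 2" "b' < 2"
  shows "link e j i b = link e' j' i' b' \<longleftrightarrow> e = e' \<and> j = j' \<and> i = i' \<and> b = b'"
  using assms joint_eq_iff[of e "j + b" "j + b'"] by (auto simp: link_def doubleton_eq_iff)

lemma links_iff:
  "a \<in> links e \<longleftrightarrow> (\<exists>j i b. a = link e j i b \<and> j < len e \<and> i < wid e \<and> b < 2)"
  by (auto simp: links_def image_iff)

lemma edges_iff:
  "a \<in> edges G \<longleftrightarrow> (\<exists>e\<in>E. \<exists>j i b. a = link e j i b \<and> j < len e \<and> i < wid e \<and> b < 2)"
  unfolding edges_G UN_iff links_iff ..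

lemma links_disjoint:
  assumes "e \<in> E" "e' \<in> E" "a \<in> links e" "a \<in> links e'"
  shows "e = e'"
proof -
  obtain j i b where "a = link e j i b" "j < len e" "b < 2"
    using assms(3) unfolding links_iff by blast
  moreover obtain j' i' b' where "a = link e' j' i' b'" "j' < len e'" "b' < 2"
    using assms(4) unfolding links_iff by blast
  ultimately show ?thesis using link_eq_iff[OF assms(1,2), of j j' b b' i i'] by simp
qed

lemma link_in_links: "j < len e \<Longrightarrow> i < wid e \<Longrightarrow> b < 2 \<Longrightarrow> link e j i b \<in> links e"
  unfolding links_iff by blast

lemma card_links: "e \<in> E \<Longrightarrow> card (links e) = len e * wid e * 2"
  unfolding links_def
  by (subst card_image) (auto simp: inj_on_def link_eq_iff card_cartesian_product)

lemma finite_links: "finite (links e)" by (simp add: links_def)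

lemma links_subset_edges: "e \<in> E \<Longrightarrow> links e \<subseteq> edges G"
  by (auto simp: edges_G)

lemma finite_edges_G: "finite (edges G)"
  using finite_E finite_links by (simp add: edges_G)

lemma finite_inner: "finite (inner e)" by (simp add: inner_def)

lemma card_inner_le: "card (inner e) \<le> len e * (1 + wid e)"
proof -
  have "card (inner e) \<le> card {0<..<len e} + card ({..<len e} \<times> {..<wid e})"
    unfolding inner_def by (intro order.trans[OF card_Un_le] add_mono card_image_le) auto
  also have "\<dots> \<le> len e * (1 + wid e)" by (simp add: card_cartesian_product)
  finally show ?thesis .
qed

lemma finite_verts_G: "finite (verts G)"
  using finite_B finite_E finite_inner by (simp add: verts_G)

lemma joint_cases:
  assumes "j \<le> len e"
  obtains "joint e j = hub (fst e)" "j = 0" | "joint e j = hub (snd e)" "j = len e"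
    | "joint e j \<in> inner e" "0 < j" "j < len e"
  using assms by (cases "j = 0"; cases "j = len e") (auto simp: inner_def)

lemma mid_in_inner: "j < len e \<Longrightarrow> i < wid e \<Longrightarrow> mid e j i \<in> inner e"
  by (force simp: inner_def)

lemma joint_in_verts: "e \<in> E \<Longrightarrow> j \<le> len e \<Longrightarrow> joint e j \<in> verts G"
  using E_base[of e] by (auto simp: verts_G elim: joint_cases)

lemma simple_graph_G: "simple_graph G"
proof -
  have "a \<subseteq> verts G \<and> card a = 2" if "a \<in> edges G" for a
  proof -
    obtain e j i b where e: "e \<in> E" and a: "a = link e j i b" "j < len e" "i < wid e" "b < 2"
      using \<open>a \<in> edges G\<close> unfolding edges_iff by blast
    have "joint e (j + b) \<in> verts G" using e a by (intro joint_in_verts) auto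
    moreover have "mid e j i \<in> verts G" using mid_in_inner[of j e i] e a by (auto simp: verts_G)
    ultimately show ?thesis by (auto simp: a link_def)
  qed
  then show ?thesis using finite_verts_G by (simp add: simple_graph_def)
qed

lemma card_verts_ge: "card B \<le> card (verts G)"
proof -
  have "card (hub ` B) \<le> card (verts G)" by (intro card_mono finite_verts_G) (auto simp: verts_G)
  then show ?thesis by (simp add: card_image inj_on_def)
qed

lemma edge_at_inner: "e \<in> E \<Longrightarrow> z \<in> inner e \<Longrightarrow> a \<in> edges G \<Longrightarrow> z \<in> a \<Longrightarrow> a \<in> links e"
proof -
  assume e: "e \<in> E" and z: "z \<in> inner e" and "a \<in> edges G" and "z \<in> a"
  then obtain e' j i b where e': "e' \<in> E" and a: "a = link e' j i b" "j < len e'" "i < wid e'" "b < 2"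
    unfolding edges_iff by blast
  have "z \<in> inner e'"
  proof (cases "z = mid e' j i")
    case True
    then show ?thesis using a by (simp add: mid_in_inner)
  next
    case False
    then have zj: "z = joint e' (j + b)" using \<open>z \<in> a\<close> by (auto simp: a link_def)
    have "j + b \<le> len e'" using a by auto
    then show ?thesis using zj z e by (auto elim: joint_cases)
  qed
  then show "a \<in> links e" using inner_disjoint[OF e e' z] a by (auto intro: link_in_links)
qed

lemma edge_at_hub:
  assumes "a \<in> edges G" "hub x \<in> a"
  shows "\<exists>e\<in>E. a \<in> links e \<and> (x = fst e \<or> x = snd e)"
proof -
  obtain e j i b where e: "e \<in> E" and a: "a = link e j i b" "j < len e" "i < wid e" "b < 2"
    using assms unfolding edges_iff by blast
  have "hub x = joint e (j + b)" using assms(2) by (auto simp: a link_def)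
  moreover have "j + b \<le> len e" using a by auto
  ultimately have "x = fst e \<or> x = snd e"
    using e by (metis joint_cases hub_eq_iff hub_notin_inner)
  then show ?thesis using e a link_in_links by blast
qed

lemma max_degree_le:
  assumes deg: "\<And>x. x \<in> B \<Longrightarrow> card {e \<in> E. x = fst e \<or> x = snd e} \<le> k"
    and M: "\<And>e. e \<in> E \<Longrightarrow> card (links e) \<le> M" and "B \<noteq> {}"
  shows "max_degree G \<le> (k + 1) * M"
proof -
  have "vdegree G z \<le> (k + 1) * M" if z: "z \<in> verts G" for z
  proof (cases "\<exists>e\<in>E. z \<in> inner e")
    case True
    then obtain e where e: "e \<in> E" "z \<in> inner e" by blast
    then have "{a \<in> edges G. z \<in> a} \<subseteq> links e" using edge_at_inner by blast
    then have "vdegree G z \<le> card (links e)"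
      unfolding vdegree_def by (intro card_mono finite_links)
    also have "\<dots> \<le> M" using M e by blast
    finally show ?thesis by simp
  next
    case False
    then obtain x where x: "x \<in> B" "z = hub x" using z by (auto simp: verts_G)
    let ?I = "{e \<in> E. x = fst e \<or> x = snd e}"
    have finI: "finite ?I" using finite_E by simp
    have "{a \<in> edges G. z \<in> a} \<subseteq> (\<Union>e\<in>?I. links e)" using edge_at_hub x by blast
    then have "vdegree G z \<le> card (\<Union>e\<in>?I. links e)"
      unfolding vdegree_def using finI finite_links by (intro card_mono) auto
    also have "\<dots> \<le> (\<Sum>e\<in>?I. card (links e))" by (rule card_UN_le[OF finI])
    also have "\<dots> \<le> (\<Sum>e\<in>?I. M)" by (intro sum_mono M) auto
    also have "\<dots> \<le> k * M" using deg[OF x(1)] by simp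
    finally show ?thesis by simp
  qed
  moreover have "verts G \<noteq> {}" using \<open>B \<noteq> {}\<close> by (auto simp: verts_G)
  ultimately show ?thesis unfolding max_degree_def using finite_verts_G by simp
qed

lemma max_degree_pos:
  assumes "E \<noteq> {}"
  shows "0 < max_degree G"
proof -
  obtain e where e: "e \<in> E" using assms by blast
  have l: "link e 0 0 0 \<in> edges G"
    using link_in_links[of 0 e 0 0] len_pos[of e] wid_pos[of e] links_subset_edges[OF e] by auto
  then have "0 < vdegree G (hub (fst e))"
    unfolding vdegree_def using finite_edges_G by (subst card_gt_0_iff) (auto simp: link_def)
  also have "\<dots> \<le> max_degree G"
    unfolding max_degree_def
    by (rule Max_ge) (use finite_verts_G E_base[OF e] in \<open>auto simp: verts_G\<close>)
  finally show ?thesis .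
qed

text \<open>
  A set $S$ of vertices either cuts a chain or treats it like its endpoints. Hence, up to a
  constant multiple of the number of cut chains, both $S$ and its complement are controlled by the
  hubs that they contain, and every base edge between a hub in $S$ and one outside is cut.
\<close>
lemma expansion:
  assumes base: "\<And>F. F \<subseteq> B \<Longrightarrow>
      min (card F) (card (B - F)) \<le> c * card {e \<in> E. (fst e \<in> F) \<noteq> (snd e \<in> F)}"
    and deg: "\<And>x. x \<in> B \<Longrightarrow> card {e \<in> E. x = fst e \<or> x = snd e} \<le> k"
    and I: "\<And>e. e \<in> E \<Longrightarrow> card (inner e) \<le> I"
    and S: "S \<subseteq> verts G" "2 * card S \<le> card (verts G)"
  shows "card S \<le> (c * (1 + k * I) + I) * card (edge_boundary G S)"
proof -
  define F where "F = {x \<in> B. hub x \<in> S}"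
  define cut where "cut = {e \<in> E. links e \<inter> edge_boundary G S \<noteq> {}}"
  have fin: "finite F" "finite cut" "finite S"
    using finite_B finite_E finite_subset[OF S(1) finite_verts_G] by (auto simp: F_def cut_def)
  have same: "joint e (j + b) \<in> S \<longleftrightarrow> mid e j i \<in> S"
    if e: "e \<in> E" "e \<notin> cut" and j: "j < len e" "i < wid e" "b < 2" for e j i b
  proof (rule ccontr)
    assume neq: "\<not> ?thesis"
    have l: "link e j i b \<in> links e" "link e j i b \<in> edges G"
      using link_in_links[OF j] links_subset_edges[OF e(1)] by auto
    then have "joint e (j + b) \<in> verts G" "mid e j i \<in> verts G"
      using simple_graph_G by (auto simp: simple_graph_def link_def)
    then have "link e j i b \<in> edge_boundary G S"
      using neq l unfolding edge_boundary_def by (auto simp: link_def insert_commute)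
    then show False using l e by (auto simp: cut_def)
  qed
  have joint_same: "joint e j \<in> S \<longleftrightarrow> hub (fst e) \<in> S"
    if e: "e \<in> E" "e \<notin> cut" and "j \<le> len e" for e j
    using \<open>j \<le> len e\<close>
  proof (induction j)
    case (Suc j)
    then show ?case
      using same[OF e, of j 0 0] same[OF e, of j 0 1] wid_pos[of e] by auto
  qed simp
  have mono: "z \<in> S \<longleftrightarrow> hub (fst e) \<in> S"
    if e: "e \<in> E" "e \<notin> cut" and "z \<in> inner e" for e z
    using that(3) joint_same[OF e] same[OF e, of _ _ 0] unfolding inner_def by auto
  have cut_F: "{e \<in> E. (fst e \<in> F) \<noteq> (snd e \<in> F)} \<subseteq> cut"
  proof
    fix e assume e: "e \<in> {e \<in> E. (fst e \<in> F) \<noteq> (snd e \<in> F)}"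
    then show "e \<in> cut" using joint_same[of e "len e"] E_base[of e] by (auto simp: F_def)
  qed
  have card_cut: "card cut \<le> card (edge_boundary G S)"
  proof (rule card_inj_on_le[of "\<lambda>e. SOME a. a \<in> links e \<inter> edge_boundary G S"])
    have some: "(SOME a. a \<in> links e \<inter> edge_boundary G S) \<in> links e \<inter> edge_boundary G S"
      if "e \<in> cut" for e
      using that unfolding cut_def by (metis (mono_tags, lifting) ex_in_conv mem_Collect_eq someI_ex)
    show "inj_on (\<lambda>e. SOME a. a \<in> links e \<inter> edge_boundary G S) cut"
    proof (rule inj_onI)
      fix e e' assume "e \<in> cut" "e' \<in> cut"
        "(SOME a. a \<in> links e \<inter> edge_boundary G S) = (SOME a. a \<in> links e' \<inter> edge_boundary G S)"
      then show "e = e'"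
        using some[of e] some[of e'] links_disjoint[of e e'] by (auto simp: cut_def)
    qed
    show "(\<lambda>e. SOME a. a \<in> links e \<inter> edge_boundary G S) ` cut \<subseteq> edge_boundary G S"
      using some by auto
    show "finite (edge_boundary G S)"
      by (rule finite_subset[OF _ finite_edges_G]) (auto simp: edge_boundary_def)
  qed
  have size: "card T \<le> (1 + k * I) * card F' + I * card cut"
    if F': "F' \<subseteq> B" and T: "T \<subseteq> hub ` F' \<union> (\<Union>e\<in>{e \<in> E. fst e \<in> F'}. inner e) \<union> (\<Union>e\<in>cut. inner e)"
    for F' T
  proof -
    have finF': "finite F'" using F' finite_B finite_subset by blast
    have "card (\<Union>e\<in>{e \<in> E. fst e \<in> F'}. inner e) \<le> card F' * (k * I)"
    proof -
      have "(\<Union>e\<in>{e \<in> E. fst e \<in> F'}. inner e)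
          \<subseteq> (\<Union>x\<in>F'. \<Union>e\<in>{e \<in> E. x = fst e \<or> x = snd e}. inner e)" by auto
      then have "card (\<Union>e\<in>{e \<in> E. fst e \<in> F'}. inner e)
          \<le> card (\<Union>x\<in>F'. \<Union>e\<in>{e \<in> E. x = fst e \<or> x = snd e}. inner e)"
        using finF' finite_E finite_inner by (intro card_mono) auto
      also have "\<dots> \<le> (\<Sum>x\<in>F'. card (\<Union>e\<in>{e \<in> E. x = fst e \<or> x = snd e}. inner e))"
        by (rule card_UN_le[OF finF'])
      also have "\<dots> \<le> (\<Sum>x\<in>F'. k * I)"
      proof (rule sum_mono)
        fix x assume "x \<in> F'"
        have "card (\<Union>e\<in>{e \<in> E. x = fst e \<or> x = snd e}. inner e)
            \<le> (\<Sum>e\<in>{e \<in> E. x = fst e \<or> x = snd e}. card (inner e))"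
          using finite_E by (intro card_UN_le) auto
        also have "\<dots> \<le> (\<Sum>e\<in>{e \<in> E. x = fst e \<or> x = snd e}. I)" by (intro sum_mono I) auto
        also have "\<dots> \<le> k * I" using deg[of x] \<open>x \<in> F'\<close> F' by auto
        finally show "card (\<Union>e\<in>{e \<in> E. x = fst e \<or> x = snd e}. inner e) \<le> k * I" .
      qed
      finally show ?thesis by simp
    qed
    moreover have "card (\<Union>e\<in>cut. inner e) \<le> card cut * I"
    proof -
      have "card (\<Union>e\<in>cut. inner e) \<le> (\<Sum>e\<in>cut. card (inner e))" by (rule card_UN_le[OF fin(2)])
      also have "\<dots> \<le> (\<Sum>e\<in>cut. I)" by (intro sum_mono I) (auto simp: cut_def)
      finally show ?thesis by simp
    qed
    moreover have "card (hub ` F') \<le> card F'" by (rule card_image_le[OF finF'])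
    moreover have "card T \<le> card (hub ` F') + card (\<Union>e\<in>{e \<in> E. fst e \<in> F'}. inner e)
        + card (\<Union>e\<in>cut. inner e)"
      using T finF' finite_E finite_inner fin
      by (intro order.trans[OF card_mono[OF _ T]] order.trans[OF card_Un_le] add_mono card_Un_le) auto
    ultimately show ?thesis by (simp add: algebra_simps)
  qed
  have cover: "(\<exists>x\<in>B. z = hub x \<and> (z \<in> S \<longleftrightarrow> x \<in> F)) \<or> z \<in> (\<Union>e\<in>cut. inner e) \<or>
      (\<exists>e\<in>E. z \<in> inner e \<and> fst e \<in> B \<and> (z \<in> S \<longleftrightarrow> fst e \<in> F))" if "z \<in> verts G" for z
    using that unfolding verts_G
  proof (elim UnE UN_E imageE)
    fix e assume e: "e \<in> E" "z \<in> inner e"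
    show ?thesis
    proof (cases "e \<in> cut")
      case False
      then have "z \<in> S \<longleftrightarrow> fst e \<in> F" using mono[OF e(1) False e(2)] E_base[OF e(1)] by (simp add: F_def)
      then show ?thesis using e E_base[OF e(1)] by blast
    qed (use e in blast)
  qed (auto simp: F_def)
  have S1: "card S \<le> (1 + k * I) * card F + I * card cut"
  proof (rule size)
    show "S \<subseteq> hub ` F \<union> (\<Union>e\<in>{e \<in> E. fst e \<in> F}. inner e) \<union> (\<Union>e\<in>cut. inner e)"
    proof
      fix z assume z: "z \<in> S"
      show "z \<in> hub ` F \<union> (\<Union>e\<in>{e \<in> E. fst e \<in> F}. inner e) \<union> (\<Union>e\<in>cut. inner e)"
        using cover[of z] z S(1) by blast
    qed
  qed (auto simp: F_def)
  have S2: "card (verts G - S) \<le> (1 + k * I) * card (B - F) + I * card cut"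
  proof (rule size)
    show "verts G - S \<subseteq> hub ` (B - F) \<union> (\<Union>e\<in>{e \<in> E. fst e \<in> B - F}. inner e) \<union> (\<Union>e\<in>cut. inner e)"
    proof
      fix z assume z: "z \<in> verts G - S"
      show "z \<in> hub ` (B - F) \<union> (\<Union>e\<in>{e \<in> E. fst e \<in> B - F}. inner e) \<union> (\<Union>e\<in>cut. inner e)"
        using cover[of z] z by blast
    qed
  qed auto
  have "card S \<le> card (verts G - S)"
    using S fin finite_verts_G by (simp add: card_Diff_subset)
  then have "card S \<le> (1 + k * I) * min (card F) (card (B - F)) + I * card cut"
    using S1 S2 by (cases "card F \<le> card (B - F)") (auto simp: min_def)
  also have "\<dots> \<le> (1 + k * I) * (c * card cut) + I * card cut"
  proof (intro add_mono mult_left_mono order.refl)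
    have "min (card F) (card (B - F)) \<le> c * card {e \<in> E. (fst e \<in> F) \<noteq> (snd e \<in> F)}"
      by (rule base) (auto simp: F_def)
    also have "\<dots> \<le> c * card cut" using card_mono[OF fin(2) cut_F] by (rule mult_left_mono) simp
    finally show "min (card F) (card (B - F)) \<le> c * card cut" .
  qed auto
  also have "\<dots> = (c * (1 + k * I) + I) * card cut" by (simp add: algebra_simps)
  also have "\<dots> \<le> (c * (1 + k * I) + I) * card (edge_boundary G S)"
    using card_cut by (rule mult_left_mono) simp
  finally show ?thesis .
qed

lemma near_joints:
  assumes e: "e \<in> E" and "j \<le> j'" "j' \<le> len e"
  shows "near G (2 * (j' - j)) (joint e j) (joint e j')"
  using assms(2,3)
proof (induction j' rule: dec_induct)
  case (step n)
  have "link e n 0 0 \<in> edges G" "link e n 0 1 \<in> edges G"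
    using link_in_links[of n e 0] links_subset_edges[OF e] step wid_pos[of e] by auto
  then have "near G 1 (joint e n) (mid e n 0)" "near G 1 (mid e n 0) (joint e (n + 1))"
    by (auto simp: link_def insert_commute near_adj simp del: One_nat_def)
  then have "near G (2 * (n - j) + (1 + 1)) (joint e j) (joint e (n + 1))"
    using step by (intro near_trans[OF step.IH near_trans]) auto
  then show ?case using step by (simp add: Suc_diff_le)
qed (simp add: near_refl)

lemma near_hubs: "e \<in> E \<Longrightarrow> near G (2 * len e) (hub (fst e)) (hub (snd e))"
  using near_joints[of e 0 "len e"] by simp

lemma inner_between_hubs:
  assumes e: "e \<in> E" and z: "z \<in> inner e"
  shows "\<exists>t\<le>2 * len e. near G t (hub (fst e)) z \<and> near G (2 * len e - t) z (hub (snd e))"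
  using z unfolding inner_def
proof (elim UnE imageE)
  fix j assume "z = joint e j" "j \<in> {0<..<len e}"
  then show ?thesis
    using near_joints[OF e, of 0 j] near_joints[OF e, of j "len e"]
    by (intro exI[of _ "2 * j"]) (auto simp: diff_mult_distrib2)
next
  fix x assume zx: "z = (\<lambda>(j, i). mid e j i) x" "x \<in> {..<len e} \<times> {..<wid e}"
  obtain j i where x: "x = (j, i)" by force
  have z: "z = mid e j i" "j < len e" "i < wid e" using zx x by auto
  have "link e j i 0 \<in> edges G" "link e j i 1 \<in> edges G"
    using link_in_links[of j e i] links_subset_edges[OF e] z by auto
  then have "near G 1 (joint e j) z" "near G 1 z (joint e (j + 1))"
    by (auto simp: link_def insert_commute z near_adj simp del: One_nat_def)
  then have "near G (2 * j + 1) (hub (fst e)) z" "near G (1 + 2 * (len e - (j + 1))) z (hub (snd e))"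
    using near_trans[OF near_joints[OF e, of 0 j], of 1 z]
      near_trans[OF _ near_joints[OF e, of "j + 1" "len e"], of 1 z] z
    by simp_all
  moreover have "1 + 2 * (len e - (j + 1)) = 2 * len e - (2 * j + 1)" using z by simp
  ultimately show ?thesis using z by (intro exI[of _ "2 * j + 1"]) auto
qed

subsection \<open>Percolation through a chain\<close>

definition passes :: "nat \<times> nat \<Rightarrow> (nat set \<Rightarrow> bool) \<Rightarrow> bool" where
  "passes e \<omega> \<longleftrightarrow> (\<forall>j\<in>{..<len e}. \<exists>i\<in>{..<wid e}. \<forall>b\<in>{..<2}. \<omega> (link e j i b))"

lemma passes_connects:
  assumes e: "e \<in> E" and "passes e \<omega>"
  shows "(hub (fst e), hub (snd e)) \<in> (adj (open_subgraph G \<omega>))\<^sup>*"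
proof -
  have "(hub (fst e), joint e j) \<in> (adj (open_subgraph G \<omega>))\<^sup>*" if "j \<le> len e" for j
    using that
  proof (induction j)
    case (Suc j)
    then obtain i where i: "i < wid e" "\<omega> (link e j i 0)" "\<omega> (link e j i 1)"
      using assms(2) unfolding passes_def by (metis Suc_le_lessD lessThan_iff one_less_numeral_iff
          pos2 semiring_norm(76))
    have "link e j i 0 \<in> edges G" "link e j i 1 \<in> edges G"
      using link_in_links[of j e i] links_subset_edges[OF e] Suc i by auto
    then have "(joint e j, mid e j i) \<in> adj (open_subgraph G \<omega>)"
      "(mid e j i, joint e (Suc j)) \<in> adj (open_subgraph G \<omega>)"
      using i by (auto simp: adj_def open_subgraph_def link_def insert_commute)
    then show ?case using Suc by (meson Suc_leD rtrancl.rtrancl_into_rtrancl)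
  qed simp
  from this[of "len e"] show ?thesis by simp
qed

lemma depends_on_passes: "depends_on (links e) (passes e)"
  unfolding depends_on_def
proof (intro allI impI)
  fix \<omega> \<omega>' :: "nat set \<Rightarrow> bool"
  assume "\<forall>a\<in>links e. \<omega> a = \<omega>' a"
  then have "\<omega> (link e j i b) = \<omega>' (link e j i b)" if "j < len e" "i < wid e" "b < 2" for j i b
    using link_in_links[OF that] by blast
  then show "passes e \<omega> = passes e \<omega>'" unfolding passes_def by auto
qed

lemma prob_not_passes_le:
  assumes e: "e \<in> E" and p: "0 \<le> p" "p \<le> 1"
  shows "measure_pmf.prob (Pi_pmf (edges G) False (\<lambda>_. bernoulli_pmf p)) {\<omega>. \<not> passes e \<omega>}
    \<le> real (len e) * (1 - p ^ 2) ^ wid e"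
proof -
  define M where "M = Pi_pmf (edges G) False (\<lambda>_. bernoulli_pmf p)"
  have single: "measure_pmf.prob M {\<omega>. \<forall>i\<in>{..<wid e}. \<not> (\<forall>b\<in>{..<2}. \<omega> (link e j i b))}
      = (1 - p ^ 2) ^ wid e" if j: "j < len e" for j
  proof -
    have half: "measure_pmf.prob M {\<omega>. \<not> (\<forall>b\<in>{..<2}. \<omega> (link e j i b))} = 1 - p ^ 2"
      if i: "i < wid e" for i
    proof -
      have "card (link e j i ` {..<2}) = 2"
        using j e by (subst card_image) (auto simp: inj_on_def link_eq_iff)
      moreover have "link e j i ` {..<2} \<subseteq> edges G"
        using link_in_links[OF j i] links_subset_edges[OF e] by blast
      ultimately have "measure_pmf.prob M {\<omega>. \<forall>a\<in>link e j i ` {..<2}. \<omega> a} = p ^ 2"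
        unfolding M_def using finite_edges_G p by (subst prob_all_open) auto
      then show ?thesis
        using prob_Collect_not[of M "\<lambda>\<omega>. \<forall>b\<in>{..<2}. \<omega> (link e j i b)"] by simp
    qed
    have "measure_pmf.prob M {\<omega>. \<forall>i\<in>{..<wid e}. \<not> (\<forall>b\<in>{..<2}. \<omega> (link e j i b))}
        = (\<Prod>i\<in>{..<wid e}. measure_pmf.prob M {\<omega>. \<not> (\<forall>b\<in>{..<2}. \<omega> (link e j i b))})"
      unfolding M_def
    proof (rule prob_all_independent[OF finite_edges_G])
      show "depends_on (link e j i ` {..<2}) (\<lambda>\<omega>. \<not> (\<forall>b\<in>{..<2}. \<omega> (link e j i b)))" for i
        unfolding depends_on_def by auto
      show "disjoint_family_on (\<lambda>i. link e j i ` {..<2}) {..<wid e}"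
        using j e by (auto simp: disjoint_family_on_def link_eq_iff)
    qed auto
    also have "\<dots> = (\<Prod>i\<in>{..<wid e}. 1 - p ^ 2)" by (intro prod.cong half) auto
    finally show ?thesis by simp
  qed
  have "{\<omega>. \<not> passes e \<omega>}
      = (\<Union>j\<in>{..<len e}. {\<omega>. \<forall>i\<in>{..<wid e}. \<not> (\<forall>b\<in>{..<2}. \<omega> (link e j i b))})"
    by (auto simp: passes_def)
  then have "measure_pmf.prob M {\<omega>. \<not> passes e \<omega>}
      \<le> (\<Sum>j\<in>{..<len e}. measure_pmf.prob M {\<omega>. \<forall>i\<in>{..<wid e}. \<not> (\<forall>b\<in>{..<2}. \<omega> (link e j i b))})"
    by (simp only:) (rule measure_pmf.finite_measure_subadditive_finite, auto)
  also have "\<dots> = (\<Sum>j\<in>{..<len e}. (1 - p ^ 2) ^ wid e)" by (intro sum.cong single) auto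
  finally show ?thesis by (simp add: M_def)
qed

end


section \<open>A binary tree whose leaves lie in an expander\<close>

text \<open>
  The base graph has the vertices of the binary tree of depth $D$ in heap order: the children of
  $x$ are $2x$ and $2x+1$. The leaves are the first $2^D$ elements of the vertex set of a vertex
  expander of size $4^D$.
\<close>
locale tree_expander =
  fixes D K L m :: nat and A :: "(nat \<times> nat) set"
  assumes K_pos: "0 < K" and L_pos: "0 < L" and m_pos: "0 < m" and D_pos: "0 < D"
    and A_sub: "A \<subseteq> {2 ^ D..<2 ^ D + 4 ^ D} \<times> {2 ^ D..<2 ^ D + 4 ^ D}"
    and sym_A: "sym A" and irrefl_A: "irrefl A"
    and A_deg: "\<And>x. card (A `` {x}) \<le> 16"
    and A_exp: "\<And>S. S \<subseteq> {2 ^ D..<2 ^ D + 4 ^ D} \<Longrightarrow> 2 * card S \<le> 4 ^ D \<Longrightarrow>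
      card S \<le> 16 * card (A `` S - S)"
begin

abbreviation V :: "nat set" where "V \<equiv> {2 ^ D..<2 ^ D + 4 ^ D}"

definition B :: "nat set" where "B = {1..<2 ^ D + 4 ^ D}"

definition tree :: "(nat \<times> nat) set" where
  "tree = {(x, y). 1 \<le> x \<and> x < 2 ^ D \<and> y div 2 = x}"

definition E :: "(nat \<times> nat) set" where
  "E = tree \<union> {(x, y) \<in> A. x < y}"

definition len :: "nat \<times> nat \<Rightarrow> nat" where "len e = (if fst e < 2 ^ D then K else L)"
definition wid :: "nat \<times> nat \<Rightarrow> nat" where "wid e = (if fst e < 2 ^ D then m else 1)"

lemma leaf_bound: "y < 2 ^ Suc D \<Longrightarrow> y < 2 ^ D + (4::nat) ^ D"
  using power_mono[of 2 "4::nat" D] by simp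

lemma tree_iff: "(x, y) \<in> tree \<longleftrightarrow> 1 \<le> x \<and> x < 2 ^ D \<and> (y = 2 * x \<or> y = 2 * x + 1)"
  by (auto simp: tree_def)

lemma tree_iff_fst: "e \<in> E \<Longrightarrow> e \<in> tree \<longleftrightarrow> fst e < 2 ^ D"
  using A_sub by (auto simp: E_def tree_def)

lemma E_not_tree: "e \<in> E \<Longrightarrow> e \<notin> tree \<Longrightarrow> e \<in> A \<and> fst e < snd e \<and> fst e \<in> V \<and> snd e \<in> V"
  using A_sub by (auto simp: E_def)

lemma A_in_E:
  assumes "(x, y) \<in> A"
  shows "(min x y, max x y) \<in> E"
proof -
  have "(y, x) \<in> A" "x \<noteq> y" using assms sym_A irrefl_A by (auto simp: irrefl_def dest: symD)
  then show ?thesis using assms by (cases "x < y") (auto simp: E_def min_def max_def)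
qed

lemma tree_in_E: "tree \<subseteq> E" by (auto simp: E_def)

sublocale chain_graph B E len wid
proof
  show "finite B" by (simp add: B_def)
  show "fst e \<in> B \<and> snd e \<in> B \<and> fst e < snd e" if "e \<in> E" for e
  proof (cases "e \<in> tree")
    case True
    then have "snd e < 2 ^ Suc D" "1 \<le> fst e" "fst e < snd e" by (auto simp: tree_def)
    then show ?thesis using leaf_bound[of "snd e"] by (auto simp: B_def)
  next
    case False
    then show ?thesis
      using E_not_tree[OF that] by (auto simp: B_def intro: order.trans[of _ "2 ^ D"])
  qed
qed (use K_pos L_pos m_pos in \<open>auto simp: len_def wid_def\<close>)

lemma finite_A: "finite A"
  by (rule finite_subset[OF A_sub]) simp

lemma finite_A_Image: "finite (A `` X)"
  using finite_A by (rule finite_Image)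

lemma V_sub_B: "V \<subseteq> B"
proof
  fix x assume "x \<in> V"
  moreover have "1 \<le> (2::nat) ^ D" by simp
  ultimately show "x \<in> B" unfolding B_def atLeastLessThan_iff by linarith
qed

lemma incident_le: "card {e \<in> E. x = fst e \<or> x = snd e} \<le> 19"
proof -
  let ?f = "\<lambda>y. (min x y, max x y)"
  have "{e \<in> E. x = fst e \<or> x = snd e} \<subseteq> {(x, 2 * x), (x, 2 * x + 1), (x div 2, x)} \<union> ?f ` (A `` {x})"
  proof
    fix e assume e: "e \<in> {e \<in> E. x = fst e \<or> x = snd e}"
    show "e \<in> {(x, 2 * x), (x, 2 * x + 1), (x div 2, x)} \<union> ?f ` (A `` {x})"
    proof (cases "e \<in> tree")
      case True
      then show ?thesis using e by (auto simp: tree_def)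
    next
      case False
      then have *: "e \<in> A" "fst e < snd e" using E_not_tree e by auto
      have "e = ?f (if x = fst e then snd e else fst e)"
        using e *(2) by (auto simp: prod_eq_iff)
      moreover have "(x, if x = fst e then snd e else fst e) \<in> A"
      proof (cases "x = fst e")
        case False
        then have "(fst e, x) \<in> A" using e *(1) by (cases e) auto
        then show ?thesis using False symD[OF sym_A] by simp
      qed (use *(1) in simp)
      ultimately show ?thesis by blast
    qed
  qed
  then have "card {e \<in> E. x = fst e \<or> x = snd e}
      \<le> card ({(x, 2 * x), (x, 2 * x + 1), (x div 2, x)} \<union> ?f ` (A `` {x}))"
    using finite_A_Image by (intro card_mono) auto
  also have "\<dots> \<le> card {(x, 2 * x), (x, 2 * x + 1), (x div 2, x)} + card (?f ` (A `` {x}))"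
    by (rule card_Un_le)
  also have "\<dots> \<le> 3 + 16"
  proof (rule add_mono)
    show "card {(x, 2 * x), (x, 2 * x + 1), (x div 2, x)} \<le> 3" by (simp add: card_insert_if)
    show "card (?f ` (A `` {x})) \<le> 16"
      using card_image_le[OF finite_A_Image[of "{x}"], of ?f] A_deg[of x] by linarith
  qed
  finally show ?thesis by simp
qed

text \<open>
  An inner vertex of the tree has two children but only one parent, so a set $X$ contains at most
  as many of them as it contains leaves, up to the number $c$ of edges that leave $X$. The
  expander bounds the part of $X$ in $V$ by $16c$, so altogether $|X| \le 2 \cdot 16c + c$.
\<close>
lemma base_expansion_aux:
  assumes X: "X \<subseteq> B" and half: "2 * card (X \<inter> V) \<le> 4 ^ D"
  shows "card X \<le> 33 * card {e \<in> E. (fst e \<in> X) \<noteq> (snd e \<in> X)}"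
proof -
  define C where "C = {e \<in> E. (fst e \<in> X) \<noteq> (snd e \<in> X)}"
  define P where "P = X \<inter> {1..<2 ^ D}"
  have finX: "finite X" using X finite_B finite_subset by blast
  have fin: "finite P" "finite C" using finX finite_E by (auto simp: P_def C_def)
  have X_split: "card X = card P + card (X \<inter> V)"
  proof -
    have "X = P \<union> (X \<inter> V)" using X by (auto simp: P_def B_def)
    moreover have "P \<inter> (X \<inter> V) = {}" by (auto simp: P_def)
    ultimately show ?thesis using finX fin by (metis card_Un_disjoint finite_Int)
  qed
  have "2 * card P \<le> card X + card C"
  proof -
    define kids where "kids = (\<lambda>x. (x, 2 * x)) ` P \<union> (\<lambda>x. (x, 2 * x + 1)) ` P"
    have "card kids = card P + card P"
    proof -
      have "(\<lambda>x. (x, 2 * x)) ` P \<inter> (\<lambda>x. (x, 2 * x + 1)) ` P = {}"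
        by auto
      then show ?thesis
        unfolding kids_def using fin(1) by (simp add: card_Un_disjoint card_image inj_on_def)
    qed
    moreover have "card kids \<le> card {e \<in> kids. snd e \<in> X} + card C"
    proof -
      have "kids \<subseteq> E" unfolding kids_def P_def E_def by (auto simp: tree_def)
      then have "kids \<subseteq> {e \<in> kids. snd e \<in> X} \<union> C" by (auto simp: C_def kids_def P_def)
      then have "card kids \<le> card ({e \<in> kids. snd e \<in> X} \<union> C)"
        using fin by (intro card_mono) (auto simp: kids_def)
      then show ?thesis using card_Un_le order.trans by blast
    qed
    moreover have "card {e \<in> kids. snd e \<in> X} \<le> card X"
    proof (rule card_inj_on_le[of snd, OF _ _ finX])
      have "fst e = snd e div 2" if "e \<in> kids" for e using that by (auto simp: kids_def)
      then show "inj_on snd {e \<in> kids. snd e \<in> X}"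
        by (intro inj_onI) (simp add: prod_eq_iff)
    qed auto
    ultimately show ?thesis by linarith
  qed
  moreover have "card (X \<inter> V) \<le> 16 * card C"
  proof -
    have "card (A `` (X \<inter> V) - X \<inter> V) \<le> card C"
    proof -
      let ?g = "\<lambda>e. if fst e \<in> X then snd e else fst e :: nat"
      have "A `` (X \<inter> V) - X \<inter> V \<subseteq> ?g ` C"
      proof
        fix y assume "y \<in> A `` (X \<inter> V) - X \<inter> V"
        then obtain x where xy: "(x, y) \<in> A" "x \<in> X" "y \<notin> X" using A_sub by auto
        have "(min x y, max x y) \<in> C"
          using A_in_E[OF xy(1)] xy(2,3) by (auto simp: C_def min_def max_def)
        moreover have "y = ?g (min x y, max x y)" using xy by (auto simp: min_def max_def)
        ultimately show "y \<in> ?g ` C" by (rule rev_image_eqI)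
      qed
      then show ?thesis using fin card_mono[of "?g ` C"] card_image_le[of C ?g] by (meson finite_imageI le_trans)
    qed
    then show ?thesis using A_exp[of "X \<inter> V"] half by auto
  qed
  ultimately show ?thesis unfolding C_def[symmetric] using X_split by linarith
qed

lemma base_expansion:
  assumes F: "F \<subseteq> B"
  shows "min (card F) (card (B - F)) \<le> 33 * card {e \<in> E. (fst e \<in> F) \<noteq> (snd e \<in> F)}"
proof (cases "2 * card (F \<inter> V) \<le> 4 ^ D")
  case True
  then show ?thesis using base_expansion_aux[OF F] by (simp add: min.coboundedI1)
next
  case False
  have "(B - F) \<inter> V = V - F \<inter> V" using V_sub_B by blast
  then have "card ((B - F) \<inter> V) = 4 ^ D - card (F \<inter> V)" by (simp add: card_Diff_subset)
  then have "2 * card ((B - F) \<inter> V) \<le> 4 ^ D" using False by linarith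
  then have "card (B - F) \<le> 33 * card {e \<in> E. (fst e \<in> B - F) \<noteq> (snd e \<in> B - F)}"
    by (intro base_expansion_aux) auto
  also have "{e \<in> E. (fst e \<in> B - F) \<noteq> (snd e \<in> B - F)} = {e \<in> E. (fst e \<in> F) \<noteq> (snd e \<in> F)}"
    using E_base by auto
  finally show ?thesis by (simp add: min.coboundedI2)
qed

text \<open>A bound for the number of inner vertices and for the number of edges of every chain. It does
  not depend on $D$.\<close>
definition chain_size :: nat where "chain_size = 2 * K * (1 + m) + 4 * L"

lemma inner_le: "card (inner e) \<le> chain_size"
proof -
  have "len e * (1 + wid e) \<le> chain_size" by (auto simp: len_def wid_def chain_size_def)
  then show ?thesis using card_inner_le[of e] by linarith
qed

lemma links_le: "e \<in> E \<Longrightarrow> card (links e) \<le> chain_size"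
  unfolding card_links len_def wid_def chain_size_def by auto

lemma B_nonempty: "B \<noteq> {}"
proof -
  have "1 < 2 ^ D + (4::nat) ^ D" by (simp add: add_strict_increasing)
  then show ?thesis by (auto simp: B_def)
qed

lemma max_degree_G: "0 < max_degree G" "max_degree G \<le> 20 * chain_size"
proof -
  have "(1::nat) < 2 ^ D" using D_pos by (intro one_less_power) auto
  then have "(1, 2) \<in> E" by (auto simp: E_def tree_def)
  then show "0 < max_degree G" using max_degree_pos by blast
  show "max_degree G \<le> 20 * chain_size"
    using max_degree_le[of 19 chain_size] incident_le links_le B_nonempty by simp
qed

lemma expander_G: "expander (1 / real (33 * (1 + 19 * chain_size) + chain_size)) (max_degree G) G"
proof -
  define c where "c = 33 * (1 + 19 * chain_size) + chain_size"
  have "real (card (edge_boundary G S)) \<ge> 1 / real c * real (card S)"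
    if "S \<subseteq> verts G" "real (card S) \<le> real (card (verts G)) / 2" for S
  proof -
    have "card S \<le> c * card (edge_boundary G S)"
      unfolding c_def
      by (rule expansion) (use that base_expansion incident_le inner_le in auto)
    then have "real (card S) \<le> real c * real (card (edge_boundary G S))"
      by (metis of_nat_le_iff of_nat_mult)
    moreover have "0 < c" by (simp add: c_def)
    ultimately show ?thesis by (simp add: field_simps)
  qed
  then show ?thesis unfolding expander_def c_def using simple_graph_G by simp
qed

lemma card_B: "card B + 1 = 2 ^ D + 4 ^ D"
proof -
  have "card B = 2 ^ D + 4 ^ D - 1" by (simp add: B_def)
  then show ?thesis by simp
qed

lemma card_verts_G_ge: "4 ^ D \<le> card (verts G)"
  using card_verts_ge card_B one_le_power[of "2::nat" D] by linarith

section \<open>The diameter\<close>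

lemma near_A_relpow: "(x, y) \<in> A ^^ k \<Longrightarrow> near G (2 * L * k) (hub x) (hub y)"
proof (induction k arbitrary: y)
  case (Suc k)
  then obtain z where z: "(x, z) \<in> A ^^ k" "(z, y) \<in> A" by auto
  have "z \<in> V" "y \<in> V" using z(2) A_sub by blast+
  then have "\<not> min z y < 2 ^ D" by (simp add: min_def)
  then have "near G (2 * L) (hub (min z y)) (hub (max z y))"
    using near_hubs[OF A_in_E[OF z(2)]] by (simp only: len_def fst_conv snd_conv if_False)
  then have "near G (2 * L) (hub z) (hub y)"
    by (cases "z \<le> y") (auto simp: min_def max_def dest: near_sym)
  from near_trans[OF Suc.IH[OF z(1)] this] show ?case by (simp add: algebra_simps)
qed (simp add: near_refl)

lemma near_V:
  assumes "x \<in> V" "y \<in> V"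
  shows "near G (96 * L * D) (hub x) (hub y)"
proof -
  \<comment> \<open>$(17/16)^{24} > 4$, so balls of radius $24D$ contain more than half of the expander.\<close>
  have "(4::real) ^ D \<le> ((17/16) ^ 24) ^ D" by (intro power_mono) (simp_all add: power_divide)
  then have "real (card V) < 2 * (17/16) ^ (24 * D)"
    by (simp add: power_mult) (smt (verit) zero_less_power)
  then obtain k where k: "k \<le> 2 * (24 * D)" "(x, y) \<in> A ^^ k"
    using expander_relpow_bound[of V A "24 * D" x y] A_sub sym_A A_exp assms by auto
  have "2 * L * k \<le> 2 * L * (2 * (24 * D))" using k(1) by (rule mult_left_mono) simp
  then show ?thesis using near_mono[OF near_A_relpow[OF k(2)]] by simp
qed

lemma tree_edge_near:
  assumes "(x, y) \<in> tree"
  shows "near G (2 * K) (hub x) (hub y)"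
proof -
  have "len (x, y) = K" using assms by (simp add: len_def tree_iff)
  then show ?thesis using near_hubs[OF subsetD[OF tree_in_E assms]] by simp
qed

lemma near_root: "y \<in> {2 ^ t..<2 ^ Suc t} \<Longrightarrow> t \<le> D \<Longrightarrow> near G (2 * K * t) (hub 1) (hub y)"
proof (induction t arbitrary: y)
  case (Suc t)
  have "2 ^ Suc t \<le> (2::nat) ^ D" using Suc.prems(2) by (intro power_increasing) auto
  then have y: "y div 2 \<in> {2 ^ t..<2 ^ Suc t}" "y div 2 < 2 ^ D" using Suc.prems(1) by auto
  moreover have "1 \<le> (2::nat) ^ t" by simp
  ultimately have "(y div 2, y) \<in> tree"
    unfolding tree_def atLeastLessThan_iff by (auto intro: order.trans)
  then have "near G (2 * K * t + 2 * K) (hub 1) (hub y)"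
    using Suc.prems y by (intro near_trans[OF Suc.IH tree_edge_near]) auto
  then show ?case by (simp add: algebra_simps)
next
  case 0
  then have "y = 1" by simp
  then show ?case by (simp add: near_refl)
qed

lemma near_leaf:
  "y \<in> {2 ^ t..<2 ^ Suc t} \<Longrightarrow> t + k = D \<Longrightarrow> \<exists>s\<in>V. near G (2 * K * k) (hub y) (hub s)"
proof (induction k arbitrary: y t)
  case 0
  then show ?case using leaf_bound[of y] by (intro bexI[of _ y]) (auto simp: near_refl)
next
  case (Suc k)
  have "2 ^ Suc t \<le> (2::nat) ^ D" using Suc.prems(2) by (intro power_increasing) auto
  then have "(y, 2 * y) \<in> tree" using Suc.prems(1) one_le_power[of "2::nat" t]
    by (auto simp: tree_def simp del: one_le_power)
  moreover obtain s where "s \<in> V" "near G (2 * K * k) (hub (2 * y)) (hub s)"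
    using Suc.IH[of "2 * y" "Suc t"] Suc.prems by auto
  ultimately have "near G (2 * K + 2 * K * k) (hub y) (hub s)"
    by (intro near_trans[OF tree_edge_near])
  then show ?case using \<open>s \<in> V\<close> by auto
qed

lemma level_exists:
  fixes x :: nat
  assumes "1 \<le> x" "x < 2 ^ D"
  obtains t where "t < D" "x \<in> {2 ^ t..<2 ^ Suc t}"
proof
  have *: "2 ^ floor_log x \<le> x" using assms by (intro floor_log_exp2_le) auto
  then show "x \<in> {2 ^ floor_log x..<2 ^ Suc (floor_log x)}" using floor_log_exp2_gt[of x] by simp
  show "floor_log x < D"
    using order.strict_trans1[OF * assms(2)] power_strict_increasing_iff[of "2::nat" "floor_log x" D]
    by simp
qed

lemma near_root_and_leaf:
  assumes "z \<in> hub ` {1..<2 ^ D} \<union> (\<Union>e\<in>tree. inner e)"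
  shows "\<exists>a\<le>2 * K * D. near G a (hub 1) z \<and> (\<exists>s\<in>V. near G (2 * K * D - a) z (hub s))"
  using assms
proof (elim UnE imageE UN_E)
  fix x assume z: "z = hub x" and "x \<in> {1..<2 ^ D}"
  then obtain t where t: "t < D" "x \<in> {2 ^ t..<2 ^ Suc t}" using level_exists[of x] by auto
  obtain s where "s \<in> V" "near G (2 * K * (D - t)) (hub x) (hub s)"
    using near_leaf[OF t(2), of "D - t"] t by auto
  then show ?thesis using near_root[OF t(2)] t z
    by (intro exI[of _ "2 * K * t"]) (auto simp: right_diff_distrib')
next
  fix e assume e: "e \<in> tree" and z: "z \<in> inner e"
  obtain x y where xy: "e = (x, y)" by force
  then obtain t where t: "t < D" "x \<in> {2 ^ t..<2 ^ Suc t}"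
    using e level_exists[of x] by (auto simp: tree_def)
  have y: "y \<in> {2 ^ Suc t..<2 ^ Suc (Suc t)}" using e t(2) by (auto simp: xy tree_iff)
  obtain s where s: "s \<in> V" "near G (2 * K * (D - Suc t)) (hub y) (hub s)"
    using near_leaf[OF y, of "D - Suc t"] t by auto
  have "len e = K" using e by (auto simp: len_def tree_def)
  then obtain a where a: "a \<le> 2 * K" "near G a (hub x) z" "near G (2 * K - a) z (hub y)"
    using inner_between_hubs[of e z] e z tree_in_E by (auto simp: xy)
  have split: "2 * K * D = 2 * K * t + 2 * K + 2 * K * (D - Suc t)"
  proof -
    obtain u where "D = Suc t + u" using t(1) less_iff_Suc_add by auto
    then show ?thesis by (simp add: algebra_simps)
  qed
  have "near G (2 * K * t + a) (hub 1) z"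
    using t by (intro near_trans[OF near_root[OF t(2)] a(2)]) auto
  moreover have "near G (2 * K - a + 2 * K * (D - Suc t)) z (hub s)"
    by (rule near_trans[OF a(3) s(2)])
  moreover have "2 * K - a + 2 * K * (D - Suc t) = 2 * K * D - (2 * K * t + a)"
    using split a(1) by linarith
  ultimately show ?thesis
    using split a(1) s(1) by (intro exI[of _ "2 * K * t + a"]) auto
qed

lemma verts_cases:
  assumes "z \<in> verts G"
  obtains "z \<in> hub ` {1..<2 ^ D} \<union> (\<Union>e\<in>tree. inner e)"
    | s where "s \<in> V" "near G (2 * L) z (hub s)"
proof (cases "z \<in> hub ` {1..<2 ^ D} \<union> (\<Union>e\<in>tree. inner e)")
  case False
  from assms show ?thesis unfolding verts_G
  proof (elim UnE imageE UN_E)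
    fix x assume "z = hub x" "x \<in> B"
    then have "x \<in> V" using False by (auto simp: B_def)
    moreover have "near G (2 * L) z (hub x)"
      unfolding \<open>z = hub x\<close> by (rule near_refl)
    ultimately show ?thesis by (rule that(2))
  next
    fix e assume e: "e \<in> E" and z: "z \<in> inner e"
    then have "e \<notin> tree" using False by auto
    then have *: "fst e \<in> V" "len e = L" using E_not_tree[OF e] by (auto simp: len_def)
    obtain a where a: "a \<le> 2 * L" "near G a (hub (fst e)) z"
      using inner_between_hubs[OF e z] unfolding *(2) by blast
    have "near G (2 * L) z (hub (fst e))" by (rule near_mono[OF near_sym[OF a(2)] a(1)])
    with *(1) show ?thesis by (rule that(2))
  qed
qed (rule that(1))

text \<open>
  Two vertices of the tree at distances $a$ and $a'$ from the root are joined through the root by a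
  path of length $a + a'$, and through leaves and the expander by one of length $4KD - a - a'$ plus
  the distance of two leaves. One of the two first lengths is at most $2KD$, the depth of the tree.
  So the diameter of $G$ exceeds the depth of the tree only by a multiple of $LD$.
\<close>
lemma diam_G_le: "diam G \<le> 2 * K * D + 96 * L * D + 4 * L"
proof (rule diam_le[OF finite_verts_G])
  show "verts G \<noteq> {}" using B_nonempty by (auto simp: verts_G)
  have TV: "near G (2 * K * D + 96 * L * D + 4 * L) y z"
    if y: "y \<in> hub ` {1..<2 ^ D} \<union> (\<Union>e\<in>tree. inner e)"
      and s: "s \<in> V" "near G (2 * L) z (hub s)" for y z s
  proof -
    obtain a s' where *: "s' \<in> V" "near G (2 * K * D - a) y (hub s')"
      using near_root_and_leaf[OF y] by blast
    show ?thesis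
      by (rule near_mono[OF near_trans[OF *(2) near_trans[OF near_V[OF *(1) s(1)] near_sym[OF s(2)]]]])
        simp
  qed
  fix y z assume y: "y \<in> verts G" and z: "z \<in> verts G"
  from y show "near G (2 * K * D + 96 * L * D + 4 * L) y z"
  proof (cases rule: verts_cases)
    case 1
    note y' = 1
    from z show ?thesis
    proof (cases rule: verts_cases)
      case 1
      obtain a s where a: "a \<le> 2 * K * D" "near G a (hub 1) y" "s \<in> V"
        "near G (2 * K * D - a) y (hub s)"
        using near_root_and_leaf[OF y'] by blast
      obtain a' s' where a': "a' \<le> 2 * K * D" "near G a' (hub 1) z" "s' \<in> V"
        "near G (2 * K * D - a') z (hub s')"
        using near_root_and_leaf[OF 1] by blast
      have up: "near G (a + a') y z" by (rule near_trans[OF near_sym[OF a(2)] a'(2)])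
      have down: "near G (2 * K * D - a + (96 * L * D + (2 * K * D - a'))) y z"
        by (rule near_trans[OF a(4) near_trans[OF near_V[OF a(3) a'(3)] near_sym[OF a'(4)]]])
      show ?thesis
      proof (cases "a + a' \<le> 2 * K * D")
        case True
        then show ?thesis by (intro near_mono[OF up]) simp
      next
        case False
        then show ?thesis using a(1) a'(1) by (intro near_mono[OF down]) linarith
      qed
    next
      case (2 s)
      then show ?thesis by (rule TV[OF y'])
    qed
  next
    case (2 s)
    note s = 2
    from z show ?thesis
    proof (cases rule: verts_cases)
      case 1
      then show ?thesis by (rule near_sym[OF TV[OF _ s]])
    next
      case (2 s')
      show ?thesis
        by (rule near_mono[OF near_trans[OF s(2) near_trans[OF near_V[OF s(1) 2(1)] near_sym[OF 2(2)]]]])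
          simp
    qed
  qed
qed


section \<open>The root is connected to a leaf\<close>

text \<open>Some path of $t$ tree edges leads downwards from $y$ such that percolation passes all their
  chains: the branching process of passed edges survives for $t$ generations.\<close>
primrec survives :: "nat \<Rightarrow> nat \<Rightarrow> (nat set \<Rightarrow> bool) \<Rightarrow> bool" where
  "survives 0 y \<omega> = True"
| "survives (Suc t) y \<omega> = (\<exists>c\<in>{2 * y, 2 * y + 1}. passes (y, c) \<omega> \<and> survives t c \<omega>)"

lemma child_level: "y \<in> {2 ^ s..<2 ^ Suc s} \<Longrightarrow> c \<in> {2 * y, 2 * y + 1} \<Longrightarrow>
    c \<in> {2 ^ Suc s..<(2::nat) ^ Suc (Suc s)}"
  by auto

lemma child_tree:
  assumes "y \<in> {2 ^ s..<2 ^ Suc s}" "s < D" "c \<in> {2 * y, 2 * y + 1}"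
  shows "(y, c) \<in> tree"
proof -
  have "2 ^ Suc s \<le> (2::nat) ^ D" using assms(2) by (intro power_increasing) auto
  moreover have "1 \<le> (2::nat) ^ s" by simp
  ultimately have "1 \<le> y \<and> y < 2 ^ D" using assms(1) unfolding atLeastLessThan_iff by linarith
  then show ?thesis using assms(3) by (auto simp: tree_iff)
qed

lemma survives_connects:
  "survives t y \<omega> \<Longrightarrow> y \<in> {2 ^ s..<2 ^ Suc s} \<Longrightarrow> s + t \<le> D \<Longrightarrow>
    \<exists>z\<in>{2 ^ (s + t)..<2 ^ Suc (s + t)}. (hub y, hub z) \<in> (adj (open_subgraph G \<omega>))\<^sup>*"
proof (induction t arbitrary: y s)
  case 0
  then show ?case by auto
next
  case (Suc t)
  then obtain c where c: "c \<in> {2 * y, 2 * y + 1}" "passes (y, c) \<omega>" "survives t c \<omega>" by auto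
  have "(y, c) \<in> tree" using Suc.prems c(1) by (intro child_tree) auto
  then have "(hub y, hub c) \<in> (adj (open_subgraph G \<omega>))\<^sup>*"
    using passes_connects[OF subsetD[OF tree_in_E] c(2)] by simp
  moreover obtain z where "z \<in> {2 ^ (Suc s + t)..<2 ^ Suc (Suc s + t)}"
    "(hub c, hub z) \<in> (adj (open_subgraph G \<omega>))\<^sup>*"
    using Suc.IH[OF c(3) child_level[OF Suc.prems(2) c(1)]] Suc.prems(3) by auto
  ultimately show ?case by (intro bexI[of _ z]) auto
qed

text \<open>The edges of $G$ that matter for the part of the tree below $c$, including the chain from the
  parent of $c$ to $c$: the ancestors of $c'$ are the numbers $c' / 2^u$, rounded down.\<close>
definition below :: "nat \<Rightarrow> nat set set" where
  "below c = (\<Union>c'\<in>{c'. 2 \<le> c' \<and> c' < 2 ^ Suc D \<and> (\<exists>u. c' div 2 ^ u = c)}. links (c' div 2, c'))"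

lemma below_child:
  assumes "c \<in> {2 * y, 2 * y + 1}"
  shows "below c \<subseteq> below y"
proof -
  have "c' div 2 ^ Suc u = y" if "c' div 2 ^ u = c" for c' u
  proof -
    have "c' div 2 ^ Suc u = c' div 2 ^ u div 2" by (metis div_mult2_eq power_Suc2)
    then show ?thesis using that assms by auto
  qed
  then show ?thesis unfolding below_def by blast
qed

lemma below_disjoint:
  assumes "1 \<le> y"
  shows "below (2 * y) \<inter> below (2 * y + 1) = {}"
proof (rule ccontr)
  assume "\<not> ?thesis"
  then obtain a where "a \<in> below (2 * y)" "a \<in> below (2 * y + 1)" by auto
  then obtain c u c' w where c: "2 \<le> c" "c < 2 ^ Suc D" "c div 2 ^ u = 2 * y" "a \<in> links (c div 2, c)"
    and c': "2 \<le> c'" "c' < 2 ^ Suc D" "c' div 2 ^ w = 2 * y + 1" "a \<in> links (c' div 2, c')"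
    unfolding below_def by blast
  have "(c div 2, c) \<in> E" "(c' div 2, c') \<in> E"
    using c(1,2) c'(1,2) tree_in_E by (auto simp: tree_def)
  then have eq: "c' = c" using links_disjoint c(4) c'(4) by blast
  show False
  proof (cases "u < w")
    case True
    then have "c div 2 ^ w = c div 2 ^ u div 2 ^ (w - u)"
      by (metis div_mult2_eq le_add_diff_inverse less_imp_le power_add)
    also have "\<dots> \<le> 2 * y" using c(3) div_le_dividend by metis
    finally show False using c'(3) eq by simp
  next
    case False
    then have "c div 2 ^ u = c div 2 ^ w div 2 ^ (u - w)"
      by (metis div_mult2_eq le_add_diff_inverse not_less power_add)
    then have *: "2 * y = (2 * y + 1) div 2 ^ (u - w)" using c(3) c'(3) eq by simp
    show False
    proof (cases "u - w")
      case (Suc v)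
      have "(2 * y + 1) div 2 ^ Suc v \<le> (2 * y + 1) div 2"
        by (intro div_le_mono2) auto
      then show False using * Suc assms by simp
    qed (use * in simp)
  qed
qed

lemma depends_on_child:
  assumes y: "y \<in> {2 ^ s..<2 ^ Suc s}" "s < D" and c: "c \<in> {2 * y, 2 * y + 1}"
    and surv: "depends_on (below c) (survives t c)"
  shows "depends_on (below c) (\<lambda>\<omega>. passes (y, c) \<omega> \<and> survives t c \<omega>)"
proof -
  have "(y, c) \<in> tree" by (rule child_tree[OF y c])
  then have "c div 2 = y" "2 \<le> c" "c < 2 ^ Suc D" by (auto simp: tree_def)
  then have "links (y, c) \<subseteq> below c"
    unfolding below_def by (intro subsetI UN_I[of c] CollectI conjI exI[of _ 0]) simp_all
  then show ?thesis
    using depends_on_conj[OF depends_on_passes[of "(y, c)"] surv] by (simp add: Un_absorb1)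
qed

lemma depends_on_survives:
  "y \<in> {2 ^ s..<2 ^ Suc s} \<Longrightarrow> s + t \<le> D \<Longrightarrow> depends_on (below y) (survives t y)"
proof (induction t arbitrary: y s)
  case 0
  then show ?case by (simp add: depends_on_def)
next
  case (Suc t)
  have "depends_on (below c) (\<lambda>\<omega>. passes (y, c) \<omega> \<and> survives t c \<omega>)"
    if c: "c \<in> {2 * y, 2 * y + 1}" for c
    using Suc.prems Suc.IH[OF child_level[OF Suc.prems(1) c]]
    by (intro depends_on_child[of y s c t] c) simp_all
  then have "depends_on (\<Union>c\<in>{2 * y, 2 * y + 1}. below c) (survives (Suc t) y)"
    unfolding survives.simps by (rule depends_on_ex)
  then show ?case
    by (rule depends_on_mono) (use below_child in blast)
qed

text \<open>
  A vertex is cut off from the leaves iff, for both of its children, the chain to the child is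
  blocked or the child is cut off itself. These are two independent events. If $\eta$ bounds the
  probability that a chain is blocked and that a child is cut off, each of them has probability at
  most $2\eta$, and $(2\eta)^2 \le \eta$ as long as $\eta \le 1/4$.
\<close>
lemma prob_not_survives_le:
  fixes p \<eta> :: real
  defines "M \<equiv> Pi_pmf (edges G) False (\<lambda>_. bernoulli_pmf p)"
  assumes \<eta>: "0 \<le> \<eta>" "\<eta> \<le> 1/4"
    and blocked: "\<And>e. e \<in> tree \<Longrightarrow> measure_pmf.prob M {\<omega>. \<not> passes e \<omega>} \<le> \<eta>"
  shows "y \<in> {2 ^ s..<2 ^ Suc s} \<Longrightarrow> s + t \<le> D \<Longrightarrow>
    measure_pmf.prob M {\<omega>. \<not> survives t y \<omega>} \<le> \<eta>"
proof (induction t arbitrary: y s)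
  case 0
  then show ?case using \<eta> by simp
next
  case (Suc t)
  define Q where "Q c \<omega> \<longleftrightarrow> \<not> (passes (y, c) \<omega> \<and> survives t c \<omega>)" for c \<omega>
  have y: "y \<in> {2 ^ s..<2 ^ Suc s}" "s < D" "1 \<le> y"
    using Suc.prems one_le_power[of "2::nat" s] by (auto simp del: one_le_power)
  have child: "measure_pmf.prob M {\<omega>. Q c \<omega>} \<le> 2 * \<eta>" if c: "c \<in> {2 * y, 2 * y + 1}" for c
  proof -
    have "{\<omega>. Q c \<omega>} = {\<omega>. \<not> passes (y, c) \<omega>} \<union> {\<omega>. \<not> survives t c \<omega>}" by (auto simp: Q_def)
    then have "measure_pmf.prob M {\<omega>. Q c \<omega>}
        \<le> measure_pmf.prob M {\<omega>. \<not> passes (y, c) \<omega>} + measure_pmf.prob M {\<omega>. \<not> survives t c \<omega>}"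
      by (simp add: measure_Un_le)
    also have "\<dots> \<le> \<eta> + \<eta>"
      using Suc.prems(2) by (intro add_mono blocked child_tree[OF y(1,2) c] Suc.IH[OF child_level[OF y(1) c]]) simp
    finally show ?thesis by simp
  qed
  have "{\<omega>. \<not> survives (Suc t) y \<omega>} = {\<omega>. \<forall>c\<in>{2 * y, 2 * y + 1}. Q c \<omega>}" by (auto simp: Q_def)
  then have "measure_pmf.prob M {\<omega>. \<not> survives (Suc t) y \<omega>}
      = measure_pmf.prob M {\<omega>. \<forall>c\<in>{2 * y, 2 * y + 1}. Q c \<omega>}" by simp
  also have "\<dots> = (\<Prod>c\<in>{2 * y, 2 * y + 1}. measure_pmf.prob M {\<omega>. Q c \<omega>})"
    unfolding M_def
  proof (rule prob_all_independent[OF finite_edges_G])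
    show "depends_on (below c) (Q c)" if c: "c \<in> {2 * y, 2 * y + 1}" for c
      unfolding Q_def using Suc.prems(2) depends_on_survives[OF child_level[OF y(1) c], of t]
      by (intro depends_on_not depends_on_child[of y s] y c) simp
    show "disjoint_family_on below {2 * y, 2 * y + 1}"
      using below_disjoint[OF y(3)] by (auto simp: disjoint_family_on_def)
  qed simp
  also have "\<dots> = measure_pmf.prob M {\<omega>. Q (2 * y) \<omega>} * measure_pmf.prob M {\<omega>. Q (2 * y + 1) \<omega>}"
    by simp
  also have "\<dots> \<le> (2 * \<eta>) * (2 * \<eta>)"
    using \<eta> by (intro mult_mono child) auto
  also have "\<dots> \<le> \<eta>" using \<eta> mult_left_mono[of \<eta> "1/4" \<eta>] by simp
  finally show ?case .
qed

text \<open>The distance from the root, with the whole expander at the height of the leaves.\<close>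
definition depth :: "nat \<Rightarrow> nat" where
  "depth z = (case from_nat z of (x :: nat, _ :: nat, j :: nat, i :: nat) \<Rightarrow>
     if x < 2 ^ D then 2 * K * floor_log x + 2 * j + (if i = 0 then 0 else 1) else 2 * K * D)"

lemma depth_hub: "depth (hub x) = (if x < 2 ^ D then 2 * K * floor_log x else 2 * K * D)"
  by (simp add: depth_def hub_def)

lemma depth_mid: "depth (mid e j i)
    = (if fst e < 2 ^ D then 2 * K * floor_log (fst e) + 2 * j + 1 else 2 * K * D)"
  by (simp add: depth_def mid_def)

lemma depth_joint:
  assumes e: "e \<in> E" and j: "j \<le> len e"
  shows "depth (joint e j)
    = (if fst e < 2 ^ D then 2 * K * floor_log (fst e) + 2 * j else 2 * K * D)"
proof (cases "fst e < 2 ^ D")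
  case True
  then have len: "len e = K" by (simp add: len_def)
  obtain x y where xy: "e = (x, y)" by force
  then have tr: "1 \<le> x" "x < 2 ^ D" "y = 2 * x \<or> y = 2 * x + 1"
    using True e tree_iff_fst[OF e] by (auto simp: tree_iff)
  have fy: "floor_log y = Suc (floor_log x)"
  proof -
    have "y div 2 = x" "2 \<le> y" using tr by auto
    then show ?thesis using floor_log_rec[of y] by (simp only:)
  qed
  obtain t where t: "t < D" "x \<in> {2 ^ t..<2 ^ Suc t}" using level_exists[OF tr(1,2)] .
  have fx: "floor_log x = t" using t(2) by (intro floor_log_eqI) (use tr in auto)
  have "depth (hub y) = 2 * K * Suc t"
  proof (cases "y < 2 ^ D")
    case False
    have "2 ^ D < (2::nat) ^ Suc (Suc t)" using False tr(3) t(2) by auto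
    then have "D < Suc (Suc t)" by (rule power_less_imp_less_exp[rotated]) simp
    then have "Suc t = D" using t(1) by simp
    then show ?thesis using False by (simp only: depth_hub if_False)
  qed (simp add: depth_hub fy fx)
  then have "depth (joint e (len e)) = 2 * K * floor_log x + 2 * K" by (simp add: xy fx)
  moreover have "depth (joint e j) = 2 * K * floor_log x + 2 * j" if "j \<noteq> len e"
    using that tr(2) by (cases "j = 0") (simp_all add: joint_def xy depth_def hub_def)
  ultimately show ?thesis using tr(2) by (cases "j = len e") (simp_all add: xy len[unfolded xy])
next
  case False
  then have "\<not> snd e < 2 ^ D" using E_base[OF e] by simp
  then show ?thesis
    using False by (cases "j = 0"; cases "j = len e") (simp_all add: joint_def depth_def hub_def)
qed

lemma depth_Lipschitz: "{x, y} \<in> edges G \<Longrightarrow> depth y \<le> depth x + 1"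
proof -
  assume "{x, y} \<in> edges G"
  then obtain e j i b where e: "e \<in> E" and a: "{x, y} = link e j i b" "j < len e" "b < 2"
    unfolding edges_iff by blast
  have "depth (joint e (j + b)) \<le> depth (mid e j i) + 1" "depth (mid e j i) \<le> depth (joint e (j + b)) + 1"
    using a by (auto simp: depth_mid depth_joint[OF e])
  then show ?thesis using a(1) by (auto simp: link_def doubleton_eq_iff)
qed

lemma survives_imp_diam_ge:
  assumes "survives D 1 \<omega>"
  shows "2 * K * D \<le> diam (component (open_subgraph G \<omega>) (hub 1))"
proof -
  obtain z where z: "2 ^ D \<le> z" "(hub 1, hub z) \<in> (adj (open_subgraph G \<omega>))\<^sup>*"
    using survives_connects[OF assms, of 0] by auto
  have "depth (hub z) \<le> depth (hub 1) + diam (component (open_subgraph G \<omega>) (hub 1))"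
  proof (rule diam_component_ge)
    show "finite (verts (open_subgraph G \<omega>))" using finite_verts_G by (simp add: open_subgraph_def)
    show "depth y \<le> depth x + 1" if "{x, y} \<in> edges (open_subgraph G \<omega>)" for x y
      using that depth_Lipschitz by (simp add: open_subgraph_def)
    show "e \<subseteq> verts (open_subgraph G \<omega>)" if "e \<in> edges (open_subgraph G \<omega>)" for e
      using that simple_graph_G by (simp add: open_subgraph_def simple_graph_def)
    show "hub 1 \<in> verts (open_subgraph G \<omega>)"
    proof -
      have "1 \<in> B" using B_nonempty by (simp add: B_def)
      then show ?thesis by (simp add: open_subgraph_def verts_G)
    qed
  qed (rule z(2))
  moreover have "depth (hub 1) = 0"
    using one_less_power[of "2::nat" D] D_pos by (simp add: depth_hub)
  ultimately show ?thesis using z(1) by (simp add: depth_hub)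
qed


section \<open>All components are small\<close>

lemma wid_expander: "e \<in> E - tree \<Longrightarrow> wid e = 1"
  and len_expander: "e \<in> E - tree \<Longrightarrow> len e = L"
  using tree_iff_fst[of e] by (simp_all add: wid_def len_def)

definition passed :: "(nat set \<Rightarrow> bool) \<Rightarrow> (nat \<times> nat) set" where
  "passed \<omega> = {(x, y) \<in> A. passes (min x y, max x y) \<omega>}"

lemma sym_passed: "sym (passed \<omega>)"
proof (rule symI)
  fix x y assume "(x, y) \<in> passed \<omega>"
  then show "(y, x) \<in> passed \<omega>"
    using symD[OF sym_A] by (simp add: passed_def min.commute[of y x] max.commute[of y x])
qed

lemma A_E_not_tree: "(x, y) \<in> A \<Longrightarrow> (min x y, max x y) \<in> E - tree"
proof -
  assume xy: "(x, y) \<in> A"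
  then have "x \<in> V" "y \<in> V" using A_sub by blast+
  then have "\<not> min x y < 2 ^ D" by (simp add: min_def)
  then show ?thesis using A_in_E[OF xy] tree_iff_fst[of "(min x y, max x y)"] by simp
qed

lemma passed_endpoints:
  assumes "e \<in> E - tree" "passes e \<omega>"
  shows "(fst e, snd e) \<in> passed \<omega>"
proof -
  have "e \<in> A" "fst e < snd e" using E_not_tree[of e] assms(1) by auto
  then show ?thesis using assms(2) by (cases e) (simp add: passed_def)
qed

text \<open>The chain of an expander edge is a path; \<open>half e q\<close> is its edge number $q$.\<close>
definition half :: "nat \<times> nat \<Rightarrow> nat \<Rightarrow> nat set" where
  "half e q = link e (q div 2) 0 (q mod 2)"

lemma passes_if_halves:
  assumes "\<And>q. q < 2 * len e \<Longrightarrow> \<omega> (half e q)"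
  shows "passes e \<omega>"
  unfolding passes_def
proof (intro ballI bexI[of _ 0])
  fix j b :: nat assume "j \<in> {..<len e}" "b \<in> {..<2}"
  then show "\<omega> (link e j 0 b)" using assms[of "2 * j + b"] by (auto simp: half_def)
qed (use wid_pos in simp)

text \<open>Position $q$ on the chain of $e$, counted from its first endpoint, is joined inside the chain
  to an endpoint in $X$.\<close>
definition reached :: "(nat set \<Rightarrow> bool) \<Rightarrow> nat set \<Rightarrow> nat \<times> nat \<Rightarrow> nat \<Rightarrow> bool" where
  "reached \<omega> X e q \<longleftrightarrow> fst e \<in> X \<and> (\<forall>q'<q. \<omega> (half e q')) \<or>
     snd e \<in> X \<and> (\<forall>q'. q \<le> q' \<and> q' < 2 * len e \<longrightarrow> \<omega> (half e q'))"

lemma reached_Suc: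
  assumes "\<omega> (half e q)"
  shows "reached \<omega> X e (Suc q) \<longleftrightarrow> reached \<omega> X e q"
proof -
  have 1: "q' < Suc q \<longleftrightarrow> q' < q \<or> q' = q" and 2: "q \<le> q' \<longleftrightarrow> q' = q \<or> Suc q \<le> q'" for q' by auto
  show ?thesis unfolding reached_def 1 2 using assms by metis
qed

lemma reached_ends:
  assumes "e \<in> E - tree" "passed \<omega> `` X \<subseteq> X"
  shows "reached \<omega> X e 0 \<longleftrightarrow> fst e \<in> X" and "reached \<omega> X e (2 * len e) \<longleftrightarrow> snd e \<in> X"
proof -
  have "fst e \<in> X \<longleftrightarrow> snd e \<in> X" if "\<And>q. q < 2 * len e \<Longrightarrow> \<omega> (half e q)"
  proof -
    have "passes e \<omega>" by (rule passes_if_halves) (rule that)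
    then have "(fst e, snd e) \<in> passed \<omega>" by (rule passed_endpoints[OF assms(1)])
    then show ?thesis using assms(2) symD[OF sym_passed] by blast
  qed
  then show "reached \<omega> X e 0 \<longleftrightarrow> fst e \<in> X" "reached \<omega> X e (2 * len e) \<longleftrightarrow> snd e \<in> X"
    unfolding reached_def by (metis le0 not_less0, metis not_less)
qed

text \<open>
  A component can only use the tree, the clusters of the leaves and the cluster where it starts,
  together with the pieces of chains that hang on these. So let $X$ be a union of clusters that
  contains the leaves. No open edge leaves the set that consists of the hubs in the tree and in
  $X$, of the tree chains, of the chains in $F$ and of what can be reached from $X$ inside other
  chains. The set $F$ is there for components that start inside a chain.
\<close>
lemma component_within_clusters:
  fixes \<omega> X F
  defines "piece \<equiv> \<lambda>e. if e \<in> tree \<union> F then inner e else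
      joint e ` {j. 0 < j \<and> j < len e \<and> reached \<omega> X e (2 * j)} \<union>
      (\<lambda>j. mid e j 0) ` {j. j < len e \<and> reached \<omega> X e (2 * j + 1)}"
  defines "Z \<equiv> hub ` ({1..<2 ^ D} \<union> X) \<union> (\<Union>e\<in>E. piece e)"
  assumes leaves: "{2 ^ D..<2 ^ Suc D} \<subseteq> X" and closed: "passed \<omega> `` X \<subseteq> X"
    and F: "F \<subseteq> E - tree" "\<And>e. e \<in> F \<Longrightarrow> fst e \<in> X \<and> snd e \<in> X" and w: "w \<in> Z"
  shows "verts (component (open_subgraph G \<omega>) w) \<subseteq> Z"
proof (rule component_subset_closed[OF w])
  have piece_inner: "piece e \<subseteq> inner e" if "e \<in> E" for e
    using that wid_pos[of e] by (auto simp: piece_def inner_def image_iff)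
  have hub_iff: "hub x \<in> Z \<longleftrightarrow> x \<in> {1..<2 ^ D} \<union> X" for x
  proof -
    have "hub x \<notin> piece e" if "e \<in> E" for e
      using piece_inner[OF that] hub_notin_inner[OF that] by blast
    then have "hub x \<in> Z \<longleftrightarrow> hub x \<in> hub ` ({1..<2 ^ D} \<union> X)" unfolding Z_def by blast
    then show ?thesis by (auto simp: image_iff)
  qed
  have inner_iff: "z \<in> Z \<longleftrightarrow> z \<in> piece e" if "e \<in> E" "z \<in> inner e" for e z
  proof -
    have "z \<in> piece e'" if "e' \<in> E" "z \<in> piece e'" "e = e'" for e' using that by simp
    moreover have "e = e'" if "e' \<in> E" "z \<in> piece e'" for e'
      using inner_disjoint[OF \<open>e \<in> E\<close> that(1) \<open>z \<in> inner e\<close>] piece_inner[OF that(1)] that(2) by blast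
    moreover have "z \<notin> hub ` ({1..<2 ^ D} \<union> X)"
      using hub_notin_inner[OF \<open>e \<in> E\<close>] \<open>z \<in> inner e\<close> by auto
    ultimately show ?thesis using \<open>e \<in> E\<close> unfolding Z_def by blast
  qed
  have full: "joint e j \<in> Z" "j' < len e \<Longrightarrow> i < wid e \<Longrightarrow> mid e j' i \<in> Z"
    if e: "e \<in> tree \<union> F" and "j \<le> len e" for e j j' i
  proof -
    have eE: "e \<in> E" using e tree_in_E F by blast
    have *: "z \<in> Z" if "z \<in> inner e" for z
      using inner_iff[OF eE that] that e by (simp add: piece_def)
    then show "j' < len e \<Longrightarrow> i < wid e \<Longrightarrow> mid e j' i \<in> Z" using mid_in_inner by blast
    have "fst e \<in> {1..<2 ^ D} \<union> X \<and> snd e \<in> {1..<2 ^ D} \<union> X"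
    proof (cases "e \<in> tree")
      case True
      then have "fst e \<in> {1..<2 ^ D}" "1 \<le> snd e" "snd e < 2 ^ Suc D" by (auto simp: tree_def)
      then have "fst e \<in> {1..<2 ^ D}" "snd e \<in> {1..<2 ^ D} \<or> snd e \<in> {2 ^ D..<2 ^ Suc D}" by auto
      then show ?thesis using leaves by blast
    qed (use e F in blast)
    then have ends: "hub (fst e) \<in> Z" "hub (snd e) \<in> Z" unfolding hub_iff by blast+
    show "joint e j \<in> Z"
      by (rule joint_cases[OF \<open>j \<le> len e\<close>]) (simp_all add: ends *)
  qed
  have rest: "joint e j \<in> Z \<longleftrightarrow> reached \<omega> X e (2 * j)"
    "j' < len e \<Longrightarrow> mid e j' 0 \<in> Z \<longleftrightarrow> reached \<omega> X e (2 * j' + 1)"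
    if e: "e \<in> E - tree - F" and j: "j \<le> len e" for e j j'
  proof -
    have eE: "e \<in> E" "e \<in> E - tree" using e by auto
    have piece: "piece e = joint e ` {j. 0 < j \<and> j < len e \<and> reached \<omega> X e (2 * j)} \<union>
      (\<lambda>j. mid e j 0) ` {j. j < len e \<and> reached \<omega> X e (2 * j + 1)}"
      using e by (simp add: piece_def)
    have "mid e j' 0 \<in> piece e \<longleftrightarrow> reached \<omega> X e (2 * j' + 1)" if "j' < len e"
      unfolding piece using that by auto
    then show "j' < len e \<Longrightarrow> mid e j' 0 \<in> Z \<longleftrightarrow> reached \<omega> X e (2 * j' + 1)"
      using inner_iff[OF eE(1) mid_in_inner[of j' e 0]] wid_pos[of e] by simp
    have V: "fst e \<in> V" "snd e \<in> V" using E_not_tree[of e] e by auto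
    show "joint e j \<in> Z \<longleftrightarrow> reached \<omega> X e (2 * j)"
    proof (cases rule: joint_cases[OF j])
      case 1
      then show ?thesis using reached_ends(1)[OF eE(2) closed] V by (auto simp: hub_iff)
    next
      case 2
      then show ?thesis using reached_ends(2)[OF eE(2) closed] V by (auto simp: hub_iff)
    next
      case 3
      have "joint e j \<in> piece e \<longleftrightarrow> reached \<omega> X e (2 * j)"
        unfolding piece using 3 joint_eq_iff[OF eE(1)] by auto
      then show ?thesis using inner_iff[OF eE(1) 3(1)] by simp
    qed
  qed
  fix z z' assume "z \<in> Z" and "{z, z'} \<in> edges (open_subgraph G \<omega>)"
  then have zz': "{z, z'} \<in> edges G" "\<omega> {z, z'}" by (auto simp: open_subgraph_def)
  then obtain e j i b where e: "e \<in> E" and a: "{z, z'} = link e j i b" "j < len e" "i < wid e" "b < 2"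
    unfolding edges_iff by blast
  have "joint e (j + b) \<in> Z \<longleftrightarrow> mid e j i \<in> Z"
  proof (cases "e \<in> tree \<union> F")
    case True
    have "j + b \<le> len e" using a by simp
    from full(1)[OF True this] full(2)[OF True this a(2,3)] show ?thesis by blast
  next
    case False
    then have e': "e \<in> E - tree - F" "e \<in> E - tree" using e by auto
    have i: "i = 0" using a(3) wid_expander[OF e'(2)] by simp
    have "half e (2 * j + b) = {z, z'}" using a(1,4) by (simp add: half_def i)
    then have "reached \<omega> X e (Suc (2 * j + b)) \<longleftrightarrow> reached \<omega> X e (2 * j + b)"
      using zz'(2) by (intro reached_Suc) simp
    moreover have "b = 0 \<or> b = 1" using a(4) by auto
    moreover have "j + b \<le> len e" using a by simp
    then have "joint e (j + b) \<in> Z \<longleftrightarrow> reached \<omega> X e (2 * (j + b))"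
      "mid e j i \<in> Z \<longleftrightarrow> reached \<omega> X e (2 * j + 1)"
      unfolding i using rest(1)[OF e'(1)] rest(2)[OF e'(1) _ a(2)] by blast+
    ultimately show ?thesis by auto
  qed
  then show "z' \<in> Z" using \<open>z \<in> Z\<close> a(1) by (auto simp: link_def doubleton_eq_iff)
qed

lemma card_tree_le: "card tree \<le> 2 * 2 ^ D"
proof -
  have "tree \<subseteq> (\<lambda>y. (y div 2, y)) ` {..<2 ^ Suc D}" by (auto simp: tree_def)
  then have "card tree \<le> card {..<(2::nat) ^ Suc D}" by (rule surj_card_le[rotated]) simp
  then show ?thesis by simp
qed

lemma card_component_le:
  assumes cluster: "\<And>x. x \<in> V \<Longrightarrow> card ((passed \<omega>)\<^sup>* `` {x}) \<le> c" and w: "w \<in> verts G"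
  shows "card (verts (component (open_subgraph G \<omega>) w)) \<le> (20 + 100 * chain_size) * 2 ^ D * c"
proof -
  obtain W F where W: "W \<subseteq> V" "card W \<le> 2" "finite W" "F \<subseteq> E - tree"
    "\<And>e. e \<in> F \<Longrightarrow> fst e \<in> W \<and> snd e \<in> W"
    and wW: "w \<in> hub ` ({1..<2 ^ D} \<union> W) \<union> (\<Union>e\<in>tree \<union> F. inner e)"
  proof -
    from w consider x where "w = hub x" "x \<in> B" | e where "e \<in> E" "w \<in> inner e" "e \<in> tree"
      | e where "e \<in> E - tree" "w \<in> inner e" unfolding verts_G by blast
    then show ?thesis
    proof cases
      case 1
      show ?thesis
      proof (cases "x < 2 ^ D")
        case True
        then show ?thesis using 1 that[of "{}" "{}"] by (auto simp: B_def)
      next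
        case False
        then have "x \<in> V" using 1 by (auto simp: B_def)
        then show ?thesis using 1 that[of "{x}" "{}"] by auto
      qed
    next
      case 2
      then show ?thesis using that[of "{}" "{}"] by auto
    next
      case 3
      then have "fst e \<in> V" "snd e \<in> V" using E_not_tree by auto
      then show ?thesis using 3 that[of "{fst e, snd e}" "{e}"] by (auto simp: card_insert_if)
    qed
  qed
  define Y where "Y = {2 ^ D..<2 ^ Suc D} \<union> W"
  define X where "X = (\<Union>x\<in>Y. (passed \<omega>)\<^sup>* `` {x})"
  have YV: "Y \<subseteq> V"
  proof
    fix y assume "y \<in> Y"
    then show "y \<in> V" using W(1) leaf_bound[of y] by (auto simp: Y_def)
  qed
  have finY: "finite Y" using W by (simp add: Y_def)
  have c_pos: "1 \<le> c"
  proof -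
    have "2 ^ D \<in> V" by simp
    moreover have "(passed \<omega>)\<^sup>* `` {2 ^ D} \<noteq> {}" by auto
    moreover have "finite ((passed \<omega>)\<^sup>* `` {2 ^ D})"
    proof (rule finite_subset)
      show "(passed \<omega>)\<^sup>* `` {2 ^ D} \<subseteq> insert (2 ^ D) V"
        using A_sub by (auto simp: passed_def elim: rtranclE)
    qed simp
    ultimately show ?thesis using cluster[of "2 ^ D"] by (metis One_nat_def Suc_leI card_gt_0_iff le_trans)
  qed
  have XV: "X \<subseteq> V"
  proof -
    have "y \<in> V" if "(x, y) \<in> (passed \<omega>)\<^sup>*" "x \<in> V" for x y
      using that by (induction rule: rtrancl_induct) (use A_sub in \<open>auto simp: passed_def\<close>)
    then show ?thesis using YV by (auto simp: X_def)
  qed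
  have YX: "Y \<subseteq> X" by (auto simp: X_def)
  have closed: "passed \<omega> `` X \<subseteq> X"
    unfolding X_def by (auto intro: rtrancl_into_rtrancl)
  have "card Y \<le> 2 ^ D + 2"
    using card_Un_le[of "{2 ^ D..<2 ^ Suc D}" W] W(2) by (simp add: Y_def)
  have cardX: "card X \<le> 3 * 2 ^ D * c"
  proof -
    have "card X \<le> (\<Sum>x\<in>Y. card ((passed \<omega>)\<^sup>* `` {x}))" unfolding X_def by (rule card_UN_le[OF finY])
    also have "\<dots> \<le> (\<Sum>x\<in>Y. c)" using cluster YV by (intro sum_mono) auto
    also have "\<dots> = card Y * c" by simp
    also have "\<dots> \<le> (2 ^ D + 2) * c" using \<open>card Y \<le> 2 ^ D + 2\<close> by (rule mult_right_mono) simp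
    also have "\<dots> \<le> (3 * 2 ^ D) * c" by (intro mult_right_mono) auto
    finally show ?thesis .
  qed
  let ?I = "chain_size"
  have Z_sub: "verts (component (open_subgraph G \<omega>) w)
    \<subseteq> hub ` ({1..<2 ^ D} \<union> X) \<union> (\<Union>e\<in>tree. inner e) \<union>
        (\<Union>x\<in>X. \<Union>e\<in>{e \<in> E. x = fst e \<or> x = snd e}. inner e)" (is "_ \<subseteq> ?U")
  proof (rule order.trans[OF component_within_clusters[of X \<omega> F w]])
    show "{2 ^ D..<2 ^ Suc D} \<subseteq> X" "passed \<omega> `` X \<subseteq> X" using YX closed by (auto simp: Y_def)
    show "F \<subseteq> E - tree" by (rule W)
    show "fst e \<in> X \<and> snd e \<in> X" if "e \<in> F" for e using W(5)[OF that] YX by (auto simp: Y_def)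
    then have FX: "e \<in> {e \<in> E. fst e = fst e \<or> fst e = snd e} \<and> fst e \<in> X" if "e \<in> F" for e
      using that W(4) by auto
    have WX: "W \<subseteq> X" using YX by (auto simp: Y_def)
    let ?piece = "\<lambda>e. if e \<in> tree \<union> F then inner e else
      joint e ` {j. 0 < j \<and> j < len e \<and> reached \<omega> X e (2 * j)} \<union>
      (\<lambda>j. mid e j 0) ` {j. j < len e \<and> reached \<omega> X e (2 * j + 1)}"
    show "w \<in> hub ` ({1..<2 ^ D} \<union> X) \<union> (\<Union>e\<in>E. ?piece e)"
    proof -
      have "tree \<union> F \<subseteq> E" using W(4) tree_in_E by blast
      then have "(\<Union>e\<in>tree \<union> F. inner e) \<subseteq> (\<Union>e\<in>E. ?piece e)" by (auto split: if_splits)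
      then show ?thesis using wW WX by blast
    qed
    have "?piece e \<subseteq> ?U" if "e \<in> E" for e
    proof (cases "e \<in> tree")
      case True
      then show ?thesis by auto
    next
      case False
      have inner: "?piece e \<subseteq> inner e" using wid_pos[of e] by (auto simp: inner_def image_iff)
      show ?thesis
      proof
        fix z assume z: "z \<in> ?piece e"
        have "\<exists>x\<in>X. x = fst e \<or> x = snd e"
        proof (cases "e \<in> F")
          case True
          then show ?thesis using FX by blast
        next
          case False
          then have "\<exists>q. reached \<omega> X e q" using z \<open>e \<notin> tree\<close> by auto
          then show ?thesis by (auto simp: reached_def)
        qed
        then obtain x where "x \<in> X" "e \<in> {e \<in> E. x = fst e \<or> x = snd e}" using \<open>e \<in> E\<close> by blast
        then show "z \<in> ?U" using inner z by blast
      qed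
    qed
    then show "hub ` ({1..<2 ^ D} \<union> X) \<union> (\<Union>e\<in>E. ?piece e) \<subseteq> ?U" by blast
  qed
  have finX: "finite X" using XV finite_subset by blast
  have fin_tree: "finite tree" using tree_in_E finite_E finite_subset by blast
  have "card (hub ` ({1..<2 ^ D} \<union> X)) \<le> 2 ^ D + card X"
  proof -
    have "card (hub ` ({1..<2 ^ D} \<union> X)) \<le> card ({1..<2 ^ D} \<union> X)"
      using finX by (intro card_image_le) simp
    also have "\<dots> \<le> card {1..<(2::nat) ^ D} + card X" by (rule card_Un_le)
    finally show ?thesis by simp
  qed
  moreover have "card (\<Union>e\<in>tree. inner e) \<le> 2 * 2 ^ D * ?I"
  proof -
    have "card (\<Union>e\<in>tree. inner e) \<le> (\<Sum>e\<in>tree. card (inner e))" by (rule card_UN_le[OF fin_tree])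
    also have "\<dots> \<le> (\<Sum>e\<in>tree. ?I)" by (intro sum_mono inner_le)
    also have "\<dots> = card tree * ?I" by simp
    also have "\<dots> \<le> 2 * 2 ^ D * ?I" using card_tree_le by (rule mult_right_mono) simp
    finally show ?thesis .
  qed
  moreover have "card (\<Union>x\<in>X. \<Union>e\<in>{e \<in> E. x = fst e \<or> x = snd e}. inner e) \<le> card X * (19 * ?I)"
  proof -
    have "card (\<Union>x\<in>X. \<Union>e\<in>{e \<in> E. x = fst e \<or> x = snd e}. inner e)
        \<le> (\<Sum>x\<in>X. card (\<Union>e\<in>{e \<in> E. x = fst e \<or> x = snd e}. inner e))"
      by (rule card_UN_le[OF finX])
    also have "\<dots> \<le> (\<Sum>x\<in>X. 19 * ?I)"
    proof (rule sum_mono)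
      fix x
      have "card (\<Union>e\<in>{e \<in> E. x = fst e \<or> x = snd e}. inner e)
          \<le> (\<Sum>e\<in>{e \<in> E. x = fst e \<or> x = snd e}. card (inner e))"
        using finite_E by (intro card_UN_le) simp
      also have "\<dots> \<le> (\<Sum>e\<in>{e \<in> E. x = fst e \<or> x = snd e}. ?I)" by (intro sum_mono inner_le)
      also have "\<dots> = card {e \<in> E. x = fst e \<or> x = snd e} * ?I" by simp
      also have "\<dots> \<le> 19 * ?I" using incident_le[of x] by (rule mult_right_mono) simp
      finally show "card (\<Union>e\<in>{e \<in> E. x = fst e \<or> x = snd e}. inner e) \<le> 19 * ?I" .
    qed
    finally show ?thesis by simp
  qed
  moreover have "card ?U \<le> card (hub ` ({1..<2 ^ D} \<union> X)) + card (\<Union>e\<in>tree. inner e)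
      + card (\<Union>x\<in>X. \<Union>e\<in>{e \<in> E. x = fst e \<or> x = snd e}. inner e)"
    by (rule order.trans[OF card_Un_le add_right_mono[OF card_Un_le]])
  moreover have "card (verts (component (open_subgraph G \<omega>) w)) \<le> card ?U"
    using finX fin_tree finite_E finite_inner by (intro card_mono Z_sub) auto
  ultimately have "card (verts (component (open_subgraph G \<omega>) w))
      \<le> 2 ^ D + card X + 2 * 2 ^ D * ?I + card X * (19 * ?I)" by linarith
  also have "\<dots> \<le> 2 ^ D * c + 3 * 2 ^ D * c + 2 * (2 ^ D * c) * ?I + 3 * 2 ^ D * c * (19 * ?I)"
    using c_pos cardX by (intro add_mono mult_right_mono mult_left_mono) auto
  also have "\<dots> \<le> (20 + 100 * ?I) * 2 ^ D * c" by (simp add: algebra_simps)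
  finally show ?thesis .
qed


definition walks :: "nat \<Rightarrow> nat \<Rightarrow> nat list set" where
  "walks k x = {xs. length xs = Suc k \<and> xs ! 0 = x \<and> (\<forall>i<k. (xs ! i, xs ! Suc i) \<in> A)}"

lemma card_walks: "finite (walks k x) \<and> card (walks k x) \<le> 16 ^ k"
proof (induction k arbitrary: x)
  case 0
  have "walks 0 x = {[x]}" by (auto simp: walks_def length_Suc_conv)
  then show ?case by simp
next
  case (Suc k)
  have sub: "walks (Suc k) x \<subseteq> (\<Union>y\<in>A `` {x}. (#) x ` walks k y)"
  proof
    fix xs assume xs: "xs \<in> walks (Suc k) x"
    then obtain ys where ys: "xs = x # ys" "length ys = Suc k" by (cases xs) (auto simp: walks_def)
    have step: "(xs ! i, xs ! Suc i) \<in> A" if "i < Suc k" for i using xs that by (simp add: walks_def)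
    have "ys \<in> walks k (ys ! 0)" using step[of "Suc _"] ys by (simp add: walks_def)
    moreover have "ys ! 0 \<in> A `` {x}" using step[of 0] ys by simp
    ultimately show "xs \<in> (\<Union>y\<in>A `` {x}. (#) x ` walks k y)" using ys by blast
  qed
  have fin: "finite (\<Union>y\<in>A `` {x}. (#) x ` walks k y)" using finite_A_Image Suc by auto
  have "card (walks (Suc k) x) \<le> card (\<Union>y\<in>A `` {x}. (#) x ` walks k y)"
    by (rule card_mono[OF fin sub])
  also have "\<dots> \<le> (\<Sum>y\<in>A `` {x}. card ((#) x ` walks k y))" by (rule card_UN_le[OF finite_A_Image])
  also have "\<dots> \<le> (\<Sum>y\<in>A `` {x}. 16 ^ k)"
  proof (rule sum_mono)
    fix y
    show "card ((#) x ` walks k y) \<le> 16 ^ k"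
      using card_image_le[of "walks k y" "(#) x"] Suc[of y] by linarith
  qed
  also have "\<dots> = card (A `` {x}) * 16 ^ k" by simp
  also have "\<dots> \<le> 16 * 16 ^ k" using A_deg by (rule mult_right_mono) simp
  finally show ?case using finite_subset[OF sub fin] by simp
qed

lemma card_relpow_Image: "card ((A ^^ k) `` {x}) \<le> 16 ^ k"
proof -
  have "(A ^^ k) `` {x} \<subseteq> (\<lambda>xs. xs ! k) ` walks k x"
  proof
    fix y assume "y \<in> (A ^^ k) `` {x}"
    then obtain f where f: "f 0 = x" "f k = y" "\<And>i. i < k \<Longrightarrow> (f i, f (Suc i)) \<in> A"
      by (auto simp: relpow_fun_conv)
    then have "map f [0..<Suc k] \<in> walks k x" by (auto simp: walks_def nth_append simp del: upt_Suc)
    moreover have "y = map f [0..<Suc k] ! k" using f(2) by (simp add: nth_append)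
    ultimately show "y \<in> (\<lambda>xs. xs ! k) ` walks k x" by (rule rev_image_eqI)
  qed
  then have "card ((A ^^ k) `` {x}) \<le> card (walks k x)"
    using card_walks by (intro surj_card_le) auto
  then show ?thesis using card_walks[of k x] by linarith
qed

definition no_long_path :: "nat \<Rightarrow> (nat set \<Rightarrow> bool) \<Rightarrow> bool" where
  "no_long_path r \<omega> \<longleftrightarrow> (\<forall>x\<in>V. \<forall>xs\<in>walks r x. distinct xs \<longrightarrow> \<not> (\<forall>i\<in>{..<r}. (xs ! i, xs ! Suc i) \<in> passed \<omega>))"

lemma card_cluster_le:
  assumes "no_long_path r \<omega>" "x \<in> V"
  shows "card ((passed \<omega>)\<^sup>* `` {x}) \<le> 16 ^ r"
proof -
  have "(passed \<omega>)\<^sup>* `` {x} \<subseteq> (\<Union>k\<in>{..<r}. (A ^^ k) `` {x})"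
  proof
    fix y assume "y \<in> (passed \<omega>)\<^sup>* `` {x}"
    then have xy: "(x, y) \<in> (passed \<omega>)\<^sup>*" by simp
    have "\<not> (f 0 = x \<and> inj_on f {..r} \<and> (\<forall>i<r. (f i, f (Suc i)) \<in> passed \<omega>))" for f
    proof
      assume f: "f 0 = x \<and> inj_on f {..r} \<and> (\<forall>i<r. (f i, f (Suc i)) \<in> passed \<omega>)"
      define xs where "xs = map f [0..<Suc r]"
      have nth: "xs ! i = f i" if "i \<le> r" for i
        using that unfolding xs_def by (subst nth_map) (auto simp del: upt_Suc)
      have "xs \<in> walks r x" using f by (auto simp: walks_def nth passed_def) (simp add: xs_def)
      moreover have "distinct xs"
        using f by (auto simp: xs_def distinct_map inj_on_def simp del: upt_Suc)
      moreover have "\<forall>i\<in>{..<r}. (xs ! i, xs ! Suc i) \<in> passed \<omega>" using f by (simp add: nth)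
      ultimately show False using assms unfolding no_long_path_def by blast
    qed
    then obtain k where "k < r" "(x, y) \<in> passed \<omega> ^^ k"
      using rtrancl_simple_path[OF xy, of r] by blast
    then have "k < r" "(x, y) \<in> A ^^ k" by (auto simp: relpow_fun_conv passed_def)
    then show "y \<in> (\<Union>k\<in>{..<r}. (A ^^ k) `` {x})" by blast
  qed
  moreover have "finite ((A ^^ k) `` {x})" for k
  proof (rule finite_subset)
    show "(A ^^ k) `` {x} \<subseteq> insert x V" using A_sub by (cases k) auto
  qed simp
  ultimately have "card ((passed \<omega>)\<^sup>* `` {x}) \<le> card (\<Union>k\<in>{..<r}. (A ^^ k) `` {x})"
    by (intro card_mono) auto
  also have "\<dots> \<le> (\<Sum>k\<in>{..<r}. card ((A ^^ k) `` {x}))" by (rule card_UN_le) simp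
  also have "\<dots> \<le> (\<Sum>k\<in>{..<r}. 16 ^ k)" by (intro sum_mono card_relpow_Image)
  also have "\<dots> \<le> 16 ^ r" by (induction r) auto
  finally show ?thesis .
qed

lemma prob_passes_expander_le:
  assumes e: "e \<in> E - tree" and p: "0 \<le> p" "p \<le> 1"
  shows "measure_pmf.prob (Pi_pmf (edges G) False (\<lambda>_. bernoulli_pmf p)) {\<omega>. passes e \<omega>}
    \<le> p ^ (2 * L)"
proof -
  define M where "M = Pi_pmf (edges G) False (\<lambda>_. bernoulli_pmf p)"
  have "\<omega> a" if open_e: "passes e \<omega>" and a_links: "a \<in> links e" for a \<omega>
  proof -
    obtain j i b where a: "a = link e j i b" "j < len e" "i < wid e" "b < 2"
      using a_links unfolding links_iff by blast
    have "i = 0" using a(3) wid_expander[OF e] by simp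
    then show ?thesis
      using open_e a wid_expander[OF e] unfolding passes_def by auto
  qed
  then have "measure_pmf.prob M {\<omega>. passes e \<omega>} \<le> measure_pmf.prob M {\<omega>. \<forall>a\<in>links e. \<omega> a}"
    by (intro measure_pmf.finite_measure_mono) auto
  also have "\<dots> = p ^ card (links e)"
    unfolding M_def using e p by (intro prob_all_open finite_edges_G links_subset_edges) auto
  also have "card (links e) = 2 * L"
    using e by (simp add: card_links wid_expander len_expander)
  finally show ?thesis by (simp add: M_def)
qed

lemma prob_walk_open_le:
  assumes xs: "xs \<in> walks r x" "distinct xs" and p: "0 \<le> p" "p \<le> 1"
  shows "measure_pmf.prob (Pi_pmf (edges G) False (\<lambda>_. bernoulli_pmf p))
      {\<omega>. \<forall>i\<in>{..<r}. (xs ! i, xs ! Suc i) \<in> passed \<omega>} \<le> (p ^ (2 * L)) ^ r"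
proof -
  define M where "M = Pi_pmf (edges G) False (\<lambda>_. bernoulli_pmf p)"
  define e where "e i = (min (xs ! i) (xs ! Suc i), max (xs ! i) (xs ! Suc i))" for i
  have A: "(xs ! i, xs ! Suc i) \<in> A" if "i < r" for i using xs(1) that by (simp add: walks_def)
  have e: "e i \<in> E - tree" if "i < r" for i unfolding e_def by (rule A_E_not_tree[OF A[OF that]])
  have len: "length xs = Suc r" using xs(1) by (simp add: walks_def)
  have inj: "i = j" if "i < r" "j < r" "e i = e j" for i j
  proof -
    have "{xs ! i, xs ! Suc i} = {xs ! j, xs ! Suc j}"
      using that(3) by (auto simp: e_def min_def max_def split: if_splits)
    then show ?thesis
      using that(1,2) len nth_eq_iff_index_eq[OF xs(2)] by (auto simp: doubleton_eq_iff)
  qed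
  have "{\<omega>. \<forall>i\<in>{..<r}. (xs ! i, xs ! Suc i) \<in> passed \<omega>} = {\<omega>. \<forall>i\<in>{..<r}. passes (e i) \<omega>}"
    using A by (auto simp: passed_def e_def)
  then have "measure_pmf.prob M {\<omega>. \<forall>i\<in>{..<r}. (xs ! i, xs ! Suc i) \<in> passed \<omega>}
      = measure_pmf.prob M {\<omega>. \<forall>i\<in>{..<r}. passes (e i) \<omega>}" by simp
  also have "\<dots> = (\<Prod>i\<in>{..<r}. measure_pmf.prob M {\<omega>. passes (e i) \<omega>})"
    unfolding M_def
  proof (rule prob_all_independent[OF finite_edges_G])
    show "disjoint_family_on (\<lambda>i. links (e i)) {..<r}"
      unfolding disjoint_family_on_def
    proof (intro ballI impI)
      fix i j assume ij: "i \<in> {..<r}" "j \<in> {..<r}" "i \<noteq> j"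
      then show "links (e i) \<inter> links (e j) = {}"
        using links_disjoint[of "e i" "e j"] e inj by blast
    qed
  qed (auto intro: depends_on_passes)
  also have "\<dots> \<le> (\<Prod>i\<in>{..<r}. p ^ (2 * L))"
    unfolding M_def using e p by (intro prod_mono conjI prob_passes_expander_le) auto
  finally show ?thesis by (simp add: M_def)
qed

text \<open>Distinct edges on a simple path are passed independently, each with probability at most
  $p^{2L}$, and at most $4^D \cdot 16^r$ walks have to be considered.\<close>
lemma prob_long_path_le:
  assumes p: "0 \<le> p" "p \<le> 1"
  shows "measure_pmf.prob (Pi_pmf (edges G) False (\<lambda>_. bernoulli_pmf p)) {\<omega>. \<not> no_long_path r \<omega>}
    \<le> 4 ^ D * (16 * p ^ (2 * L)) ^ r"
proof -
  define M where "M = Pi_pmf (edges G) False (\<lambda>_. bernoulli_pmf p)"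
  define W where "W = (\<Union>x\<in>V. {xs \<in> walks r x. distinct xs})"
  have W_fin: "finite W" using card_walks by (auto simp: W_def)
  have "card W \<le> (\<Sum>x\<in>V. card {xs \<in> walks r x. distinct xs})" unfolding W_def by (rule card_UN_le) simp
  also have "\<dots> \<le> (\<Sum>x\<in>V. 16 ^ r)"
  proof (rule sum_mono)
    fix x
    have "card {xs \<in> walks r x. distinct xs} \<le> card (walks r x)"
      using card_walks[of r x] by (intro card_mono) auto
    then show "card {xs \<in> walks r x. distinct xs} \<le> 16 ^ r" using card_walks[of r x] by linarith
  qed
  finally have W_card: "card W \<le> 4 ^ D * 16 ^ r" by simp
  have "{\<omega>. \<not> no_long_path r \<omega>} = (\<Union>xs\<in>W. {\<omega>. \<forall>i\<in>{..<r}. (xs ! i, xs ! Suc i) \<in> passed \<omega>})"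
    by (auto simp: no_long_path_def W_def)
  then have "measure_pmf.prob M {\<omega>. \<not> no_long_path r \<omega>}
      \<le> (\<Sum>xs\<in>W. measure_pmf.prob M {\<omega>. \<forall>i\<in>{..<r}. (xs ! i, xs ! Suc i) \<in> passed \<omega>})"
    using measure_pmf.finite_measure_subadditive_finite[OF W_fin] by simp
  also have "\<dots> \<le> (\<Sum>xs\<in>W. (p ^ (2 * L)) ^ r)"
  proof (rule sum_mono)
    fix xs assume "xs \<in> W"
    then obtain x where "xs \<in> walks r x" "distinct xs" by (auto simp: W_def)
    then show "measure_pmf.prob M {\<omega>. \<forall>i\<in>{..<r}. (xs ! i, xs ! Suc i) \<in> passed \<omega>} \<le> (p ^ (2 * L)) ^ r"
      unfolding M_def using p by (rule prob_walk_open_le)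
  qed
  also have "\<dots> = real (card W) * (p ^ (2 * L)) ^ r" by simp
  also have "\<dots> \<le> real (4 ^ D * 16 ^ r) * (p ^ (2 * L)) ^ r"
    using W_card p by (intro mult_right_mono of_nat_mono) auto
  finally show ?thesis by (simp add: M_def power_mult_distrib)
qed

end


section \<open>Choice of the parameters\<close>

lemma exists_power_le:
  fixes q y :: real
  assumes "0 \<le> q" "q < 1" "0 < y"
  shows "\<exists>n>0. q ^ n \<le> y"
proof -
  obtain n where n: "q ^ n < y" using real_arch_pow_inv[OF assms(3,2)] by blast
  have "q ^ Suc n \<le> q ^ n" using assms by (intro power_decreasing) auto
  then show ?thesis using n by (intro exI[of _ "Suc n"]) auto
qed

lemma tree_expander_exists:
  assumes "0 < K" "0 < L" "0 < m" "0 < D"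
  shows "\<exists>A. tree_expander D K L m A"
proof -
  let ?V = "{2 ^ D..<2 ^ D + 4 ^ D} :: nat set"
  obtain A where "A \<subseteq> ?V \<times> ?V" "sym A" "irrefl A" "\<forall>x. card (A `` {x}) \<le> 16"
    "\<forall>S\<subseteq>?V. 2 * card S \<le> card ?V \<longrightarrow> card S \<le> 16 * card (A `` S - S)"
    using vertex_expander_exists[of ?V] by blast
  then have "tree_expander D K L m A" using assms by unfold_locales auto
  then show ?thesis ..
qed

text \<open>
  The order in which the parameters are chosen matters: the length $L$ of the chains in the
  expander only depends on $p$, it determines the length $K$ of the tree chains, and their width
  $m$ comes last. The depth is $D = 16r$, so that there are $4^D \cdot 16^r = 2^{36r}$ walks to
  consider, clusters have at most $16^r = 2^{D/4}$ vertices, and components at most about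
  $2^{5D/4}$ out of more than $2^{2D}$.
\<close>
lemma percolation_examples:
  fixes p \<eta> :: real
  assumes p: "0 < p" "p < 1" and \<eta>: "0 < \<eta>" "\<eta> \<le> 1/4"
  shows "\<exists>b>0. \<exists>(d_max::nat) (C::nat). \<forall>r>0. \<exists>(H :: nat ugraph) v.
    4 ^ (16 * r) \<le> card (verts H) \<and> expander b (max_degree H) H \<and>
    0 < max_degree H \<and> max_degree H \<le> d_max \<and> v \<in> verts H \<and>
    1 - \<eta> \<le> measure_pmf.prob (percolation H p)
      {G. (1 - \<eta>) * real (diam H) \<le> real (diam (component G v))} \<and>
    1 - (1/2) ^ r \<le> measure_pmf.prob (percolation H p)
      {G. \<forall>w\<in>verts G. card (verts (component G w)) \<le> C * 2 ^ (20 * r)}"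
proof -
  \<comment> \<open>There will be $2^{36r}$ walks of length $r$ in the expander.\<close>
  obtain l where l: "0 < l" "p ^ l \<le> 1 / 2 ^ 37"
    using exists_power_le[of p "1 / 2 ^ 37"] p by auto
  define L where "L = l"
  have L: "0 < L" "p ^ (2 * L) \<le> 1 / 2 ^ 37"
  proof -
    have "p ^ (2 * L) \<le> p ^ l" using p by (intro power_decreasing) (auto simp: L_def)
    then show "p ^ (2 * L) \<le> 1 / 2 ^ 37" using l(2) by linarith
  qed (use l in \<open>simp add: L_def\<close>)
  \<comment> \<open>The part of the diameter that is due to the expander is at most $100LD$, which has to be
    small compared to the depth $2KD$ of the tree.\<close>
  define K where "K = nat \<lceil>50 * real L / \<eta>\<rceil>"
  have K_ge: "50 * real L \<le> \<eta> * real K"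
  proof -
    have "50 * real L / \<eta> \<le> real K" unfolding K_def by (rule real_nat_ceiling_ge)
    then show ?thesis using \<eta> by (simp add: field_simps)
  qed
  have K: "0 < K"
  proof (rule ccontr)
    assume "\<not> ?thesis"
    then show False using K_ge L(1) by simp
  qed
  have "0 \<le> 1 - p ^ 2" "1 - p ^ 2 < 1" using p by (simp_all add: power_le_one)
  then obtain m where m: "0 < m" "(1 - p ^ 2) ^ m \<le> \<eta> / real K"
    using exists_power_le[of "1 - p ^ 2" "\<eta> / real K"] \<eta> K by auto
  define I where "I = tree_expander.chain_size K L m"
  define C where "C = 20 + 100 * I"
  show ?thesis
  proof (rule exI[of _ "1 / real (33 * (1 + 19 * I) + I)"], rule conjI[rotated],
      rule exI[of _ "20 * I"], rule exI[of _ C], intro allI impI)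
    show "0 < 1 / real (33 * (1 + 19 * I) + I)" by simp
    fix r :: nat assume r: "0 < r"
    define D where "D = 16 * r"
    have "0 < D" using r by (simp add: D_def)
    then obtain A where "tree_expander D K L m A"
      using tree_expander_exists[OF K L(1) m(1)] by blast
    then interpret T: tree_expander D K L m A .
    define M where "M = Pi_pmf (edges T.G) False (\<lambda>_. bernoulli_pmf p)"
    have diam: "(1 - \<eta>) * real (diam T.G) \<le> 2 * real K * real D"
    proof -
      have "diam T.G \<le> 2 * K * D + 96 * L * D + 4 * L" by (rule T.diam_G_le)
      also have "\<dots> \<le> 2 * K * D + 100 * L * D"
        using mult_le_mono2[of 1 D "4 * L"] \<open>0 < D\<close> by simp
      finally have "real (diam T.G) \<le> real (2 * K * D + 100 * L * D)" by (rule of_nat_mono)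
      then have "(1 - \<eta>) * real (diam T.G) \<le> (1 - \<eta>) * real (2 * K * D + 100 * L * D)"
        using \<eta> by (intro mult_left_mono) auto
      also have "\<dots> = ((1 - \<eta>) * (2 * real K + 100 * real L)) * real D" by (simp add: algebra_simps)
      also have "\<dots> \<le> (2 * real K) * real D"
      proof (rule mult_right_mono)
        have "0 \<le> \<eta> * real L" using \<eta> by simp
        then show "(1 - \<eta>) * (2 * real K + 100 * real L) \<le> 2 * real K"
          using K_ge by (simp add: algebra_simps)
      qed simp
      finally show ?thesis .
    qed
    have blocked: "measure_pmf.prob M {\<omega>. \<not> T.passes e \<omega>} \<le> \<eta>" if e: "e \<in> T.tree" for e
    proof -
      have "measure_pmf.prob M {\<omega>. \<not> T.passes e \<omega>} \<le> real (T.len e) * (1 - p ^ 2) ^ T.wid e"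
        unfolding M_def using p e T.tree_in_E by (intro T.prob_not_passes_le) auto
      also have "\<dots> = real K * (1 - p ^ 2) ^ m"
        using e by (auto simp: T.len_def T.wid_def T.tree_def)
      also have "\<dots> \<le> \<eta>" using m(2) K by (simp add: field_simps)
      finally show ?thesis .
    qed
    have far: "1 - \<eta> \<le> measure_pmf.prob M
        {\<omega>. (1 - \<eta>) * real (diam T.G) \<le> real (diam (component (open_subgraph T.G \<omega>) (hub 1)))}"
    proof -
      have "measure_pmf.prob M {\<omega>. \<not> T.survives D 1 \<omega>} \<le> \<eta>"
        unfolding M_def
        by (rule T.prob_not_survives_le[of \<eta> p 1 0 D]) (use \<eta> blocked in \<open>auto simp: M_def\<close>)
      then have "1 - \<eta> \<le> measure_pmf.prob M {\<omega>. T.survives D 1 \<omega>}"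
        by (simp add: prob_Collect_not)
      also have "\<dots> \<le> measure_pmf.prob M
        {\<omega>. (1 - \<eta>) * real (diam T.G) \<le> real (diam (component (open_subgraph T.G \<omega>) (hub 1)))}"
      proof (intro measure_pmf.finite_measure_mono subsetI CollectI)
        fix \<omega> assume "\<omega> \<in> {\<omega>. T.survives D 1 \<omega>}"
        then have "2 * K * D \<le> diam (component (open_subgraph T.G \<omega>) (hub 1))"
          using T.survives_imp_diam_ge by simp
        then have "real (2 * K * D) \<le> real (diam (component (open_subgraph T.G \<omega>) (hub 1)))"
          by (rule of_nat_mono)
        then show "(1 - \<eta>) * real (diam T.G) \<le> real (diam (component (open_subgraph T.G \<omega>) (hub 1)))"
          using diam by simp
      qed simp
      finally show ?thesis .
    qed
    have small: "1 - (1/2) ^ r \<le> measure_pmf.prob M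
        {\<omega>. \<forall>w\<in>verts T.G. card (verts (component (open_subgraph T.G \<omega>) w)) \<le> C * 2 ^ (20 * r)}"
    proof -
      have "measure_pmf.prob M {\<omega>. \<not> T.no_long_path r \<omega>} \<le> 4 ^ D * (16 * p ^ (2 * L)) ^ r"
        unfolding M_def using p by (intro T.prob_long_path_le) auto
      also have "\<dots> = (4 ^ 16 * (16 * p ^ (2 * L))) ^ r"
        by (simp only: D_def power_mult power_mult_distrib)
      also have "\<dots> \<le> (1/2) ^ r" using L(2) p by (intro power_mono) auto
      finally have "1 - (1/2) ^ r \<le> measure_pmf.prob M {\<omega>. T.no_long_path r \<omega>}"
        by (simp add: prob_Collect_not)
      also have "\<dots> \<le> measure_pmf.prob M
        {\<omega>. \<forall>w\<in>verts T.G. card (verts (component (open_subgraph T.G \<omega>) w)) \<le> C * 2 ^ (20 * r)}"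
      proof (intro measure_pmf.finite_measure_mono subsetI CollectI ballI)
        fix \<omega> w assume \<omega>: "\<omega> \<in> {\<omega>. T.no_long_path r \<omega>}" and w: "w \<in> verts T.G"
        have "card (verts (component (open_subgraph T.G \<omega>) w)) \<le> (20 + 100 * I) * 2 ^ D * 16 ^ r"
          unfolding I_def using \<omega> by (intro T.card_component_le T.card_cluster_le w) simp_all
        also have "(2::nat) ^ D * 16 ^ r = 2 ^ (20 * r)"
        proof -
          have "(16::nat) ^ r = 2 ^ (4 * r)" by (simp add: power_mult)
          then show ?thesis by (simp add: D_def flip: power_add)
        qed
        then have "(20 + 100 * I) * 2 ^ D * 16 ^ r = C * 2 ^ (20 * r)" by (simp add: C_def mult.assoc)
        finally show "card (verts (component (open_subgraph T.G \<omega>) w)) \<le> C * 2 ^ (20 * r)" .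
      qed simp
      finally show ?thesis .
    qed
    have "hub 1 \<in> verts T.G"
    proof -
      have "1 \<in> T.B" using T.B_nonempty by (simp add: T.B_def)
      then show ?thesis by (simp add: T.verts_G)
    qed
    moreover have "verts (open_subgraph T.G \<omega>) = verts T.G" for \<omega> by (simp add: open_subgraph_def)
    ultimately show "\<exists>(H :: nat ugraph) v.
      4 ^ (16 * r) \<le> card (verts H) \<and> expander (1 / real (33 * (1 + 19 * I) + I)) (max_degree H) H \<and>
      0 < max_degree H \<and> max_degree H \<le> 20 * I \<and> v \<in> verts H \<and>
      1 - \<eta> \<le> measure_pmf.prob (percolation H p)
        {G. (1 - \<eta>) * real (diam H) \<le> real (diam (component G v))} \<and>
      1 - (1/2) ^ r \<le> measure_pmf.prob (percolation H p)
        {G. \<forall>w\<in>verts G. card (verts (component G w)) \<le> C * 2 ^ (20 * r)}"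
      using far small T.card_verts_G_ge T.expander_G T.max_degree_G
      by (intro exI[of _ T.G] exI[of _ "hub 1"]) (simp add: prob_percolation M_def I_def D_def)
  qed
qed

lemma small_power_bound:
  assumes "C \<le> r" "4 ^ (16 * r) \<le> n"
  shows "real (C * 2 ^ (20 * r)) \<le> real n powr (1 - 1/8)"
proof -
  have "C < 2 ^ C" by (rule less_exp)
  also have "(2::nat) ^ C \<le> 2 ^ r" using assms(1) by (intro power_increasing) auto
  also have "(2::nat) ^ r \<le> 2 ^ (8 * r)" by (intro power_increasing) auto
  finally have "C * 2 ^ (20 * r) \<le> 2 ^ (8 * r) * 2 ^ (20 * r)" by (intro mult_right_mono) auto
  also have "\<dots> = 2 ^ (28 * r)" by (simp flip: power_add)
  finally have "real (C * 2 ^ (20 * r)) \<le> real (2 ^ (28 * r))" by (rule of_nat_mono)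
  also have "\<dots> = 2 powr (28 * real r)" by (simp add: powr_realpow[symmetric])
  also have "\<dots> = (2 powr (32 * real r)) powr (1 - 1/8)" by (simp add: powr_powr)
  also have "\<dots> \<le> real n powr (1 - 1/8)"
  proof (rule powr_mono2)
    have "2 powr (32 * real r) = 2 ^ (32 * r)" by (simp add: powr_realpow[symmetric])
    also have "(2::real) ^ (32 * r) = real (4 ^ (16 * r))" by (simp add: power_mult)
    also have "\<dots> \<le> real n" using assms(2) by (rule of_nat_mono)
    finally show "2 powr (32 * real r) \<le> real n" .
  qed auto
  finally show ?thesis .
qed

theorem theorem3:
  fixes \<epsilon> p :: real
  assumes "\<epsilon> > 0" and "0 < p" and "p < 1"
  shows "\<exists>(b::real) (d::nat) (\<delta>::real) (N::nat set) (\<G> :: nat \<Rightarrow> nat ugraph) (v :: nat \<Rightarrow> nat).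
    b > 0 \<and> d > 0 \<and> \<delta> > 0 \<and> infinite N \<and>
    (\<forall>n\<in>N. card (verts (\<G> n)) = n \<and> expander b d (\<G> n) \<and> v n \<in> verts (\<G> n) \<and>
       measure_pmf.prob (percolation (\<G> n) p)
         {G. real (diam (component G (v n))) \<ge> (1 - \<epsilon>) * real (diam (\<G> n))} \<ge> 1 - \<epsilon>) \<and>
    ((\<lambda>n. measure_pmf.prob (percolation (\<G> n) p)
         {G. \<forall>w\<in>verts G. real (card (verts (component G w))) \<le> real n powr (1 - \<delta>)})
       \<longlongrightarrow> 1) (inf sequentially (principal N))"
proof -
  define \<eta> where "\<eta> = min \<epsilon> (1/4)"
  have \<eta>: "0 < \<eta>" "\<eta> \<le> 1/4" "\<eta> \<le> \<epsilon>" using assms by (auto simp: \<eta>_def)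
  obtain b d_max C where b: "b > 0" and ex: "\<forall>r>0. \<exists>(H :: nat ugraph) v.
    4 ^ (16 * r) \<le> card (verts H) \<and> expander b (max_degree H) H \<and>
    0 < max_degree H \<and> max_degree H \<le> d_max \<and> v \<in> verts H \<and>
    1 - \<eta> \<le> measure_pmf.prob (percolation H p)
      {G. (1 - \<eta>) * real (diam H) \<le> real (diam (component G v))} \<and>
    1 - (1/2) ^ r \<le> measure_pmf.prob (percolation H p)
      {G. \<forall>w\<in>verts G. card (verts (component G w)) \<le> C * 2 ^ (20 * r)}"
    using percolation_examples[OF assms(2,3) \<eta>(1,2)] by blast
  define R where "R = {r. 0 < r \<and> C \<le> r}"
  have "\<forall>r\<in>R. \<exists>(H :: nat ugraph) v.
    4 ^ (16 * r) \<le> card (verts H) \<and> expander b (max_degree H) H \<and>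
    0 < max_degree H \<and> max_degree H \<le> d_max \<and> v \<in> verts H \<and>
    1 - \<eta> \<le> measure_pmf.prob (percolation H p)
      {G. (1 - \<eta>) * real (diam H) \<le> real (diam (component G v))} \<and>
    1 - (1/2) ^ r \<le> measure_pmf.prob (percolation H p)
      {G. \<forall>w\<in>verts G. card (verts (component G w)) \<le> C * 2 ^ (20 * r)}"
    using ex by (simp add: R_def)
  then obtain H :: "nat \<Rightarrow> nat ugraph" and v :: "nat \<Rightarrow> nat" where H:
    "\<And>r. r \<in> R \<Longrightarrow> 4 ^ (16 * r) \<le> card (verts (H r))"
    "\<And>r. r \<in> R \<Longrightarrow> expander b (max_degree (H r)) (H r)"
    "\<And>r. r \<in> R \<Longrightarrow> 0 < max_degree (H r)" "\<And>r. r \<in> R \<Longrightarrow> max_degree (H r) \<le> d_max"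
    "\<And>r. r \<in> R \<Longrightarrow> v r \<in> verts (H r)"
    "\<And>r. r \<in> R \<Longrightarrow> 1 - \<eta> \<le> measure_pmf.prob (percolation (H r) p)
      {G. (1 - \<eta>) * real (diam (H r)) \<le> real (diam (component G (v r)))}"
    "\<And>r. r \<in> R \<Longrightarrow> 1 - (1/2) ^ r \<le> measure_pmf.prob (percolation (H r) p)
      {G. \<forall>w\<in>verts G. card (verts (component G w)) \<le> C * 2 ^ (20 * r)}"
    unfolding bchoice_iff by (elim exE) blast
  have "infinite R"
  proof
    assume "finite R"
    then obtain k where "\<forall>r\<in>R. r \<le> k" using finite_nat_set_iff_bounded_le by auto
    moreover have "Suc (k + C) \<in> R" by (simp add: R_def)
    ultimately show False by fastforce
  qed
  moreover have "finite ((\<lambda>r. max_degree (H r)) ` R)"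
    by (rule finite_subset[of _ "{..d_max}"]) (use H(4) in auto)
  \<comment> \<open>The maximum degree has to be the same for all graphs, so restrict to a value that occurs
    infinitely often.\<close>
  ultimately obtain r0 where r0: "r0 \<in> R" "infinite {r \<in> R. max_degree (H r) = max_degree (H r0)}"
    using pigeonhole_infinite by blast
  define d where "d = max_degree (H r0)"
  define R' where "R' = {r \<in> R. max_degree (H r) = d}"
  define N where "N = (\<lambda>r. card (verts (H r))) ` R'"
  define \<rho> where "\<rho> n = (SOME r. r \<in> R' \<and> card (verts (H r)) = n)" for n
  have "infinite R'" using r0 by (simp add: R'_def d_def)
  have \<rho>: "\<rho> n \<in> R'" "card (verts (H (\<rho> n))) = n" if "n \<in> N" for n
  proof -
    have "\<exists>r. r \<in> R' \<and> card (verts (H r)) = n" using that by (auto simp: N_def)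
    then have "\<rho> n \<in> R' \<and> card (verts (H (\<rho> n))) = n" unfolding \<rho>_def by (rule someI_ex)
    then show "\<rho> n \<in> R'" "card (verts (H (\<rho> n))) = n" by auto
  qed
  have R'_R: "r \<in> R" if "r \<in> R'" for r using that by (simp add: R'_def)
  have "infinite N"
  proof
    assume "finite N"
    then obtain k where k: "\<forall>n\<in>N. n \<le> k" using finite_nat_set_iff_bounded_le by auto
    have "r \<le> k" if r: "r \<in> R'" for r
    proof -
      have "r < 4 ^ r" by (rule less_exp[THEN order.strict_trans2]) (rule power_mono, auto)
      also have "(4::nat) ^ r \<le> 4 ^ (16 * r)" by (intro power_increasing) auto
      also have "\<dots> \<le> card (verts (H r))" by (rule H(1)[OF R'_R[OF r]])
      also have "\<dots> \<le> k" using k r by (auto simp: N_def)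
      finally show ?thesis by simp
    qed
    then show False using \<open>infinite R'\<close> finite_nat_set_iff_bounded_le by blast
  qed
  have \<rho>_top: "filterlim \<rho> at_top (inf sequentially (principal N))"
    unfolding filterlim_at_top eventually_inf_principal
  proof
    fix z
    define k where "k = (\<Sum>r<z. card (verts (H r)))"
    have "z \<le> \<rho> n" if "k < n" "n \<in> N" for n
    proof (rule ccontr)
      assume "\<not> z \<le> \<rho> n"
      then have "card (verts (H (\<rho> n))) \<le> k" unfolding k_def by (intro member_le_sum) auto
      then show False using \<rho>(2)[OF that(2)] that(1) by simp
    qed
    then show "\<forall>\<^sub>F n in sequentially. n \<in> N \<longrightarrow> z \<le> \<rho> n"
      using eventually_mono[OF eventually_gt_at_top[of k]] by simp
  qed
  have lim: "((\<lambda>n. measure_pmf.prob (percolation (H (\<rho> n)) p)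
      {G. \<forall>w\<in>verts G. real (card (verts (component G w))) \<le> real n powr (1 - 1/8)})
      \<longlongrightarrow> 1) (inf sequentially (principal N))"
  proof (rule tendsto_sandwich)
    have "((\<lambda>n. 1 - (1/2) ^ \<rho> n) \<longlongrightarrow> 1 - (0::real)) (inf sequentially (principal N))"
      by (intro tendsto_intros filterlim_compose[OF LIMSEQ_power_zero \<rho>_top]) auto
    then show "((\<lambda>n. 1 - (1/2 :: real) ^ \<rho> n) \<longlongrightarrow> 1) (inf sequentially (principal N))" by simp
    have "1 - (1/2) ^ \<rho> n \<le> measure_pmf.prob (percolation (H (\<rho> n)) p)
      {G. \<forall>w\<in>verts G. real (card (verts (component G w))) \<le> real n powr (1 - 1/8)}"
      if n: "n \<in> N" for n
    proof -
      have r: "\<rho> n \<in> R" "C \<le> \<rho> n" using \<rho>(1)[OF n] by (auto simp: R'_def R_def)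
      have "real (C * 2 ^ (20 * \<rho> n)) \<le> real n powr (1 - 1/8)"
        using small_power_bound[OF r(2) H(1)[OF r(1)]] \<rho>(2)[OF n] by simp
      then have "{G. \<forall>w\<in>verts G. card (verts (component G w)) \<le> C * 2 ^ (20 * \<rho> n)}
        \<subseteq> {G. \<forall>w\<in>verts G. real (card (verts (component G w))) \<le> real n powr (1 - 1/8)}"
        by (auto intro: order.trans[OF of_nat_mono])
      from order.trans[OF H(7)[OF r(1)] measure_pmf.finite_measure_mono[OF this]] show ?thesis
        by simp
    qed
    then show "\<forall>\<^sub>F n in inf sequentially (principal N). 1 - (1/2) ^ \<rho> n \<le>
      measure_pmf.prob (percolation (H (\<rho> n)) p)
      {G. \<forall>w\<in>verts G. real (card (verts (component G w))) \<le> real n powr (1 - 1/8)}"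
      by (simp add: eventually_inf_principal)
  qed (auto simp: measure_pmf.prob_le_1)
  have main: "card (verts (H (\<rho> n))) = n \<and> expander b d (H (\<rho> n)) \<and> v (\<rho> n) \<in> verts (H (\<rho> n)) \<and>
      1 - \<epsilon> \<le> measure_pmf.prob (percolation (H (\<rho> n)) p)
        {G. (1 - \<epsilon>) * real (diam (H (\<rho> n))) \<le> real (diam (component G (v (\<rho> n))))}"
    if n: "n \<in> N" for n
  proof -
    have r: "\<rho> n \<in> R" "max_degree (H (\<rho> n)) = d" using \<rho>(1)[OF n] by (auto simp: R'_def)
    have "(1 - \<epsilon>) * real (diam (H (\<rho> n))) \<le> (1 - \<eta>) * real (diam (H (\<rho> n)))"
      using \<eta>(3) by (intro mult_right_mono) auto
    then have "measure_pmf.prob (percolation (H (\<rho> n)) p)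
          {G. (1 - \<eta>) * real (diam (H (\<rho> n))) \<le> real (diam (component G (v (\<rho> n))))}
        \<le> measure_pmf.prob (percolation (H (\<rho> n)) p)
          {G. (1 - \<epsilon>) * real (diam (H (\<rho> n))) \<le> real (diam (component G (v (\<rho> n))))}"
      by (intro measure_pmf.finite_measure_mono) auto
    then have "1 - \<epsilon> \<le> measure_pmf.prob (percolation (H (\<rho> n)) p)
        {G. (1 - \<epsilon>) * real (diam (H (\<rho> n))) \<le> real (diam (component G (v (\<rho> n))))}"
      using H(6)[OF r(1)] \<eta>(3) by linarith
    then show ?thesis using \<rho>(2)[OF n] H(2,5)[OF r(1)] r(2) by simp
  qed
  have "0 < d" using H(3)[OF r0(1)] by (simp add: d_def)
  then show ?thesis
    using b \<open>infinite N\<close> main lim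
    by (intro exI[of _ b] exI[of _ d] exI[of _ "1/8"] exI[of _ N] exI[of _ "\<lambda>n. H (\<rho> n)"]
        exI[of _ "\<lambda>n. v (\<rho> n)"]) simp
qed

end
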